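(* Let $R$ be a Noetherian ring, $M$ a finitely generated $R$-module and $I_1,\dots,I_t$ ideals of $R$. Then there exists $k\in\mathbb N$ such that for all $n_1,\dots,n_t\in\mathbb N$ and all ideals $J\subseteq R$, \[ J^{k|\underline n|}M\cap\big(I_1^{n_1}\cdots I_t^{n_t}M:_M J^{\infty}\big)\subseteq I_1^{n_1}\cdots I_t^{n_t}M, \] equivalently \[ I_1^{n_1}\cdots I_t^{n_t}M=\big(J^{k|\underline n|}M+I_1^{n_1}\cdots I_t^{n_t}M\big)\cap\big(I_1^{n_1}\cdots I_t^{n_t}M:_M J^{\infty}\big), \] where $|\underline n|=n_1+\cdots+n_t$.
   Context: $\mathbb N=\{0,1,2,\dots\}$, with $I^0=R$. For a submodule $N\subseteq M$ and an ideal $J$, $(N:_M J^{\infty})=\bigcup_{i\ge 0}(N:_M J^i)$, where $(N:_M J^i)=\{x\in M: J^i x\subseteq N\}$. *)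

theory Defs
  imports Complex_Main
begin

text \<open>Commutative ring R = a type of class comm_ring_1; ideals are the submodules of
R over itself.  A module is given by a scalar multiplication satisfying the locale
module (from HOL Modules); the module M is the whole carrier type.\<close>

definition ideal :: "'a::comm_ring_1 set \<Rightarrow> bool" where
  "ideal I \<longleftrightarrow> module.subspace ((*) :: 'a \<Rightarrow> 'a \<Rightarrow> 'a) I"

definition ideal_span :: "'a::comm_ring_1 set \<Rightarrow> 'a set" where
  "ideal_span S = module.span ((*) :: 'a \<Rightarrow> 'a \<Rightarrow> 'a) S"

definition noetherian_ring :: "'a::comm_ring_1 itself \<Rightarrow> bool" where
  "noetherian_ring _ \<longleftrightarrow>
     (\<forall>I :: 'a set. ideal I \<longrightarrow> (\<exists>S. finite S \<and> I = ideal_span S))"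

definition ideal_prod :: "'a::comm_ring_1 set \<Rightarrow> 'a set \<Rightarrow> 'a set" where
  "ideal_prod I J = ideal_span {a * b | a b. a \<in> I \<and> b \<in> J}"

primrec ideal_pow :: "'a::comm_ring_1 set \<Rightarrow> nat \<Rightarrow> 'a set" where
  "ideal_pow I 0 = UNIV"
| "ideal_pow I (Suc n) = ideal_prod I (ideal_pow I n)"

primrec ideal_multipow :: "(nat \<Rightarrow> 'a::comm_ring_1 set) \<Rightarrow> (nat \<Rightarrow> nat) \<Rightarrow> nat \<Rightarrow> 'a set" where
  "ideal_multipow I n 0 = UNIV"
| "ideal_multipow I n (Suc t) = ideal_prod (ideal_multipow I n t) (ideal_pow (I t) (n t))"

definition ideal_smult ::
  "('a::comm_ring_1 \<Rightarrow> 'm::ab_group_add \<Rightarrow> 'm) \<Rightarrow> 'a set \<Rightarrow> 'm set \<Rightarrow> 'm set" where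
  "ideal_smult scale I N = module.span scale {scale a x | a x. a \<in> I \<and> x \<in> N}"

definition colon ::
  "('a::comm_ring_1 \<Rightarrow> 'm::ab_group_add \<Rightarrow> 'm) \<Rightarrow> 'm set \<Rightarrow> 'a set \<Rightarrow> 'm set" where
  "colon scale N J = {x. \<forall>a\<in>J. scale a x \<in> N}"

definition colon_inf ::
  "('a::comm_ring_1 \<Rightarrow> 'm::ab_group_add \<Rightarrow> 'm) \<Rightarrow> 'm set \<Rightarrow> 'a set \<Rightarrow> 'm set" where
  "colon_inf scale N J = (\<Union>i. colon scale N (ideal_pow J i))"

definition fin_gen_module :: "('a::comm_ring_1 \<Rightarrow> 'm::ab_group_add \<Rightarrow> 'm) \<Rightarrow> bool" where
  "fin_gen_module scale \<longleftrightarrow> (\<exists>S. finite S \<and> module.span scale S = UNIV)"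

end

theory Submission
  imports Defs "HOL-Library.Function_Algebras"
begin

text \<open>
  Write \<open>M\<^sub>n = I\<^sup>n M\<close> for multi-indices \<open>n\<close>, and climb from \<open>M\<^sub>0 = M\<close> to \<open>M\<^sub>n\<close> one unit vector at a time.
  The Rees module, with components \<open>M\<^sub>n\<close>, is noetherian over its operators \<open>a T\<^sub>i\<close> with \<open>a\<close> in \<open>I\<^sub>i\<close>.
  This makes two facts uniform in \<open>n\<close>. First, for every \<open>J\<close> there is a larger ideal \<open>J'\<close> from a fixed
  finite list such that an element of \<open>M\<^sub>n\<close> that some power of \<open>J\<close> sends into \<open>M\<^bsub>n+e\<^esub>\<close>
  (\<open>e\<close> a unit vector) is sent there by \<open>J'\<^sup>r\<close> already.
  So \<open>J\<close> may be replaced by one of finitely many ideals \<open>J'\<close>, for which the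
  Artin-Rees lemma gives, secondly, a constant \<open>k\<close> such that an element of
  \<open>J'\<^sup>m M\<^sub>n\<close>, \<open>m \<ge> k\<close>, which is sent into \<open>M\<^bsub>n+e\<^esub>\<close> by \<open>J'\<^sup>r\<close> lies in \<open>J'\<^bsup>m-k\<^esup> M\<^bsub>n+e\<^esub>\<close>.
  Each of the \<open>|n|\<close> steps thus costs \<open>k\<close> powers of \<open>J'\<close>.
\<close>

section \<open>Ideals and their action on a module\<close>

lemma module_mult: "module ((*) :: 'a::comm_ring_1 \<Rightarrow> 'a \<Rightarrow> 'a)"
  by unfold_locales (simp_all add: algebra_simps)

lemma ideal_iff:
  "ideal I \<longleftrightarrow> 0 \<in> I \<and> (\<forall>x\<in>I. \<forall>y\<in>I. x + y \<in> I) \<and> (\<forall>c. \<forall>x\<in>I. c * x \<in> I)"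
  by (simp add: ideal_def module.subspace_def[OF module_mult])

lemma ideal_UNIV [simp]: "ideal UNIV"
  by (simp add: ideal_iff)

lemma ideal_Int: "ideal I \<Longrightarrow> ideal J \<Longrightarrow> ideal (I \<inter> J)"
  by (simp add: ideal_iff)

lemma ideal_mult_left: "ideal I \<Longrightarrow> x \<in> I \<Longrightarrow> c * x \<in> I"
  by (simp add: ideal_iff)

lemma ideal_ideal_span: "ideal (ideal_span S)"
  unfolding ideal_def ideal_span_def by (rule module.subspace_span[OF module_mult])

lemma ideal_span_superset: "S \<subseteq> ideal_span S"
  unfolding ideal_span_def by (rule module.span_superset[OF module_mult])

lemma ideal_span_minimal: "S \<subseteq> I \<Longrightarrow> ideal I \<Longrightarrow> ideal_span S \<subseteq> I"
  unfolding ideal_def ideal_span_def by (rule module.span_minimal[OF module_mult])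

lemma ideal_ideal_prod: "ideal (ideal_prod I J)"
  unfolding ideal_prod_def by (rule ideal_ideal_span)

lemma ideal_prod_mem: "a \<in> I \<Longrightarrow> b \<in> J \<Longrightarrow> a * b \<in> ideal_prod I J"
  unfolding ideal_prod_def by (rule subsetD[OF ideal_span_superset]) blast

lemma ideal_prod_minimal:
  assumes "ideal K" "\<And>a b. a \<in> I \<Longrightarrow> b \<in> J \<Longrightarrow> a * b \<in> K"
  shows "ideal_prod I J \<subseteq> K"
  unfolding ideal_prod_def using assms by (intro ideal_span_minimal) auto

lemma ideal_prod_mono: "I \<subseteq> I' \<Longrightarrow> J \<subseteq> J' \<Longrightarrow> ideal_prod I J \<subseteq> ideal_prod I' J'"
  by (intro ideal_prod_minimal ideal_ideal_prod ideal_prod_mem) auto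

lemma ideal_ideal_pow: "ideal (ideal_pow I n)"
  by (cases n) (simp_all add: ideal_ideal_prod)

lemma ideal_pow_mono: "I \<subseteq> J \<Longrightarrow> ideal_pow I n \<subseteq> ideal_pow J n"
  by (induction n) (simp_all add: ideal_prod_mono)

lemma ideal_pow_antimono: "m \<le> n \<Longrightarrow> ideal_pow I n \<subseteq> ideal_pow I m"
proof (induction n rule: dec_induct)
  case (step n)
  have "ideal_pow I (Suc n) \<subseteq> ideal_pow I n"
    by (simp, rule ideal_prod_minimal) (auto intro: ideal_ideal_pow ideal_mult_left)
  with step show ?case by blast
qed simp

lemma power_mem_ideal_pow: "b \<in> J \<Longrightarrow> b ^ m \<in> ideal_pow J m"
  by (induction m) (simp_all add: ideal_prod_mem)

lemma ideal_multipow_cong: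
  "(\<And>i. i < t \<Longrightarrow> I i = I' i) \<Longrightarrow> (\<And>i. i < t \<Longrightarrow> n i = n' i) \<Longrightarrow>
    ideal_multipow I n t = ideal_multipow I' n' t"
  by (induction t) auto

lemma ideal_multipow_zero: "ideal_multipow I (\<lambda>_. 0) t = UNIV"
proof (induction t)
  case (Suc t)
  have "x * 1 \<in> ideal_prod UNIV UNIV" for x :: 'a by (rule ideal_prod_mem) auto
  then show ?case using Suc by auto
qed simp

text \<open>This compatibility is what lets the shifts act on the Rees module. In the inductive step
  the element of \<open>I i\<close> goes into the last power when \<open>i = t\<close>, and into the
  earlier factors otherwise.\<close>

lemma ideal_multipow_Suc_mem:
  assumes "i < t" "a \<in> I i" "b \<in> ideal_multipow I n t"
  shows "a * b \<in> ideal_multipow I (n(i := Suc (n i))) t"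
  using assms
proof (induction t arbitrary: b)
  case (Suc t)
  let ?n = "n(i := Suc (n i))"
  have "ideal_multipow I n (Suc t) \<subseteq> {b. a * b \<in> ideal_multipow I ?n (Suc t)}"
    unfolding ideal_multipow.simps(2)
  proof (rule ideal_prod_minimal)
    show "ideal {b. a * b \<in> ideal_prod (ideal_multipow I ?n t) (ideal_pow (I t) (?n t))}"
      using ideal_ideal_prod[of "ideal_multipow I ?n t" "ideal_pow (I t) (?n t)"]
      unfolding ideal_iff by (simp add: distrib_left mult.left_commute)
    fix x y assume xy: "x \<in> ideal_multipow I n t" "y \<in> ideal_pow (I t) (n t)"
    show "x * y \<in> {b. a * b \<in> ideal_prod (ideal_multipow I ?n t) (ideal_pow (I t) (?n t))}"
    proof (cases "i = t")
      case True
      have "x * (a * y) \<in> ideal_prod (ideal_multipow I ?n t) (ideal_pow (I t) (?n t))"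
      proof (rule ideal_prod_mem)
        show "x \<in> ideal_multipow I ?n t"
          using xy(1) ideal_multipow_cong[of t I I n ?n] True by auto
        show "a * y \<in> ideal_pow (I t) (?n t)"
          using True Suc.prems xy(2) by (simp add: ideal_prod_mem)
      qed
      then show ?thesis by (simp add: mult.left_commute)
    next
      case False
      with Suc.prems have "i < t" by simp
      have "(a * x) * y \<in> ideal_prod (ideal_multipow I ?n t) (ideal_pow (I t) (?n t))"
      proof (rule ideal_prod_mem)
        show "a * x \<in> ideal_multipow I ?n t" by (rule Suc.IH[OF \<open>i < t\<close> Suc.prems(2) xy(1)])
        show "y \<in> ideal_pow (I t) (?n t)" using xy(2) False by simp
      qed
      then show ?thesis by (simp add: mult.assoc)
    qed
  qed
  with Suc.prems(3) show ?case by blast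
qed simp

lemma ideal_multipow_antimono:
  assumes "\<And>i. i < t \<Longrightarrow> m i \<le> n i"
  shows "ideal_multipow I n t \<subseteq> ideal_multipow I m t"
  using assms by (induction t) (simp_all add: ideal_prod_mono ideal_pow_antimono)

section \<open>Chain conditions in a noetherian ring\<close>

text \<open>The union of the chain is an ideal, and its finitely many generators already lie in one
  member.\<close>

lemma noetherian_ring_acc:
  fixes K :: "nat \<Rightarrow> 'a::comm_ring_1 set"
  assumes R: "noetherian_ring TYPE('a)" and K: "\<And>j. ideal (K j)" and "incseq K"
  shows "\<exists>c. \<forall>d\<ge>c. K d = K c"
proof -
  have mono: "K i \<subseteq> K j" if "i \<le> j" for i j
    using that \<open>incseq K\<close> by (simp add: incseqD)
  have "ideal (\<Union>j. K j)"
    unfolding ideal_iff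
  proof (intro conjI ballI allI)
    show "0 \<in> (\<Union>j. K j)" using K by (auto simp: ideal_iff)
    fix x y assume "x \<in> (\<Union>j. K j)" "y \<in> (\<Union>j. K j)"
    then obtain i j where "x \<in> K i" "y \<in> K j" by auto
    then have "x \<in> K (max i j)" "y \<in> K (max i j)"
      using mono[of i "max i j"] mono[of j "max i j"] by auto
    then show "x + y \<in> (\<Union>j. K j)" using K by (auto simp: ideal_iff)
  next
    fix c x assume "x \<in> (\<Union>j. K j)"
    then show "c * x \<in> (\<Union>j. K j)" using K ideal_mult_left by blast
  qed
  then obtain S where S: "finite S" "(\<Union>j. K j) = ideal_span S"
    using R unfolding noetherian_ring_def by meson
  then have "S \<subseteq> (\<Union>j. K j)" using ideal_span_superset by blast
  with S(1) have "\<exists>c. S \<subseteq> K c"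
  proof (induction S rule: finite_induct)
    case (insert x S)
    then obtain i j where "x \<in> K i" "S \<subseteq> K j" by auto
    then have "insert x S \<subseteq> K (max i j)"
      using mono[of i "max i j"] mono[of j "max i j"] by auto
    then show ?case by blast
  qed simp
  then obtain c where c: "S \<subseteq> K c" by blast
  have "(\<Union>j. K j) \<subseteq> K c"
    using ideal_span_minimal[OF c K] S(2) by simp
  then have "K d = K c" if "d \<ge> c" for d using mono[OF that] by blast
  then show ?thesis by blast
qed

text \<open>Without a maximal member, dependent choice would build a strictly ascending chain of
  ideals.\<close>

lemma noetherian_ring_maximal:
  fixes \<K> :: "'a::comm_ring_1 set set"
  assumes R: "noetherian_ring TYPE('a)" and K: "\<And>K. K \<in> \<K> \<Longrightarrow> ideal K" and ne: "K0 \<in> \<K>"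
  shows "\<exists>P\<in>\<K>. \<forall>K\<in>\<K>. P \<subseteq> K \<longrightarrow> K = P"
proof (rule ccontr)
  assume "\<not> ?thesis"
  then have *: "\<exists>K'. K' \<in> \<K> \<and> K \<subset> K'" if "K \<in> \<K>" for K
    using that by (metis psubsetI)
  have "\<exists>f. \<forall>j::nat. f j \<in> \<K> \<and> f j \<subset> f (Suc j)"
  proof (rule dependent_nat_choice)
    show "\<exists>K. K \<in> \<K>" using ne by (rule exI)
  qed (rule *)
  then obtain f where f: "\<And>j::nat. f j \<in> \<K>" "\<And>j. f j \<subset> f (Suc j)" by blast
  have "incseq f" using f(2) by (intro incseq_SucI) auto
  from noetherian_ring_acc[of f, OF R K[OF f(1)] this] obtain c where c: "\<And>d. d \<ge> c \<Longrightarrow> f d = f c" by metis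
  have "f (Suc c) = f c" by (rule c) simp
  with f(2)[of c] show False by simp
qed

section \<open>Products of ideals with submodules, and colon submodules\<close>

context module
begin

lemma subspace_ideal_smult: "subspace (ideal_smult scale I N)"
  unfolding ideal_smult_def by (rule subspace_span)

lemma ideal_smult_mem: "a \<in> I \<Longrightarrow> x \<in> N \<Longrightarrow> a *s x \<in> ideal_smult scale I N"
  unfolding ideal_smult_def by (rule span_base) blast

lemma ideal_smult_minimal:
  assumes "subspace K" "\<And>a x. a \<in> I \<Longrightarrow> x \<in> N \<Longrightarrow> a *s x \<in> K"
  shows "ideal_smult scale I N \<subseteq> K"
  unfolding ideal_smult_def using assms by (intro span_minimal) auto

lemma ideal_smult_mono:
  "I \<subseteq> I' \<Longrightarrow> N \<subseteq> N' \<Longrightarrow> ideal_smult scale I N \<subseteq> ideal_smult scale I' N'"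
  by (intro ideal_smult_minimal subspace_ideal_smult ideal_smult_mem) auto

lemma subspace_scale_vimage:
  assumes "subspace N"
  shows "subspace {u. a *s u \<in> N}"
proof (rule subspaceI)
  fix c x assume "x \<in> {u. a *s u \<in> N}"
  then have "c *s (a *s x) \<in> N" using assms subspace_scale by blast
  then show "c *s x \<in> {u. a *s u \<in> N}" by (simp add: mult.commute)
qed (use assms in \<open>auto simp: scale_right_distrib subspace_0 subspace_add\<close>)

text \<open>This ideal is the annihilator of \<open>u\<close> modulo \<open>N\<close>.\<close>

lemma ideal_scale_vimage: "subspace N \<Longrightarrow> ideal {a. a *s u \<in> N}"
  using subspace_0[of N] subspace_add[of N] subspace_scale[of N "_ *s u"]
  unfolding ideal_iff by (simp add: scale_left_distrib)

lemma ideal_smult_scale: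
  assumes "\<And>x. x \<in> N \<Longrightarrow> a *s x \<in> N'" "u \<in> ideal_smult scale I N"
  shows "a *s u \<in> ideal_smult scale I N'"
proof -
  have "ideal_smult scale I N \<subseteq> {u. a *s u \<in> ideal_smult scale I N'}"
  proof (rule ideal_smult_minimal)
    show "subspace {u. a *s u \<in> ideal_smult scale I N'}"
      by (intro subspace_scale_vimage subspace_ideal_smult)
    fix b x assume "b \<in> I" "x \<in> N"
    then have "b *s (a *s x) \<in> ideal_smult scale I N'"
      by (intro ideal_smult_mem assms)
    then show "b *s x \<in> {u. a *s u \<in> ideal_smult scale I N'}"
      by (simp add: mult.commute)
  qed
  with assms(2) show ?thesis by blast
qed

lemma ideal_smult_pow_Suc:
  assumes "a \<in> J" "u \<in> ideal_smult scale (ideal_pow J m) N"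
  shows "a *s u \<in> ideal_smult scale (ideal_pow J (Suc m)) N"
proof -
  have "ideal_smult scale (ideal_pow J m) N
      \<subseteq> {u. a *s u \<in> ideal_smult scale (ideal_pow J (Suc m)) N}"
  proof (rule ideal_smult_minimal)
    show "subspace {u. a *s u \<in> ideal_smult scale (ideal_pow J (Suc m)) N}"
      by (intro subspace_scale_vimage subspace_ideal_smult)
    fix b x assume "b \<in> ideal_pow J m" "x \<in> N"
    then have "(a * b) *s x \<in> ideal_smult scale (ideal_pow J (Suc m)) N"
      using assms(1) by (intro ideal_smult_mem) (auto intro: ideal_prod_mem)
    then show "b *s x \<in> {u. a *s u \<in> ideal_smult scale (ideal_pow J (Suc m)) N}"
      by simp
  qed
  with assms(2) show ?thesis by blast
qed

lemma subspace_colon: "subspace N \<Longrightarrow> subspace (colon scale N J)"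
proof -
  assume "subspace N"
  then have "subspace (\<Inter>a\<in>J. {u. a *s u \<in> N})"
    by (intro subspace_Int subspace_scale_vimage)
  moreover have "(\<Inter>a\<in>J. {u. a *s u \<in> N}) = colon scale N J" by (auto simp: colon_def)
  ultimately show ?thesis by simp
qed

lemma colon_antimono: "I \<subseteq> J \<Longrightarrow> colon scale N J \<subseteq> colon scale N I"
  by (auto simp: colon_def)

lemma colon_mono: "N \<subseteq> N' \<Longrightarrow> colon scale N J \<subseteq> colon scale N' J"
  by (auto simp: colon_def)

lemma colon_scale: "subspace N \<Longrightarrow> x \<in> colon scale N J \<Longrightarrow> a *s x \<in> colon scale N J"
  using subspace_colon subspace_scale by blast

end

section \<open>Noetherian modules with operators\<close>

text \<open>The sum of all \<open>x^e L\<close> with \<open>e < d\<close>: polynomials in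
  \<open>x\<close> of degree below \<open>d\<close> with coefficients in \<open>L\<close>. The sum
  need not be direct, so coefficients need not be unique.\<close>

primrec poly_part :: "('b::ab_group_add \<Rightarrow> 'b) \<Rightarrow> 'b set \<Rightarrow> nat \<Rightarrow> 'b set" where
  "poly_part x L 0 = {0}"
| "poly_part x L (Suc d) = {(x ^^ d) a + b | a b. a \<in> L \<and> b \<in> poly_part x L d}"

text \<open>Plays the role of a submodule over the polynomial ring \<open>R[\<Phi>]\<close> when the
  operators are linear and commute. Working with a set of operators avoids multivariate polynomials,
  and \<open>\<Phi> = {}\<close> gives plain submodules.\<close>

definition operator_submodule ::
    "('a::comm_ring_1 \<Rightarrow> 'b::ab_group_add \<Rightarrow> 'b) \<Rightarrow> ('b \<Rightarrow> 'b) set \<Rightarrow> 'b set \<Rightarrow> bool" where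
  "operator_submodule scale \<Phi> U \<longleftrightarrow> module.subspace scale U \<and> (\<forall>\<phi>\<in>\<Phi>. \<forall>u\<in>U. \<phi> u \<in> U)"

definition operator_noetherian ::
    "('a::comm_ring_1 \<Rightarrow> 'b::ab_group_add \<Rightarrow> 'b) \<Rightarrow> ('b \<Rightarrow> 'b) set \<Rightarrow> 'b set \<Rightarrow> bool" where
  "operator_noetherian scale \<Phi> L \<longleftrightarrow>
     (\<forall>U. (\<forall>j. operator_submodule scale \<Phi> (U j) \<and> U j \<subseteq> L) \<and> incseq U \<longrightarrow>
       (\<exists>c::nat. \<forall>d\<ge>c. U d = U c))"

context module
begin

lemma operator_submoduleD:
  assumes "operator_submodule scale \<Phi> U"
  shows "subspace U" "\<And>\<phi> u. \<phi> \<in> \<Phi> \<Longrightarrow> u \<in> U \<Longrightarrow> \<phi> u \<in> U"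
  using assms by (auto simp: operator_submodule_def)

lemma operator_noetherianD:
  assumes "operator_noetherian scale \<Phi> L" "\<And>j. operator_submodule scale \<Phi> (U j)" "\<And>j. U j \<subseteq> L" "incseq U"
  obtains c :: nat where "\<And>d. d \<ge> c \<Longrightarrow> U d = U c"
  using assms unfolding operator_noetherian_def by metis

text \<open>More operators leave fewer stable submodules, hence fewer chains. This serves to pass
  from shifts by generators of the ideals to shifts by all their elements.\<close>

lemma operator_noetherian_mono:
  assumes "operator_noetherian scale \<Phi> L" "\<Phi> \<subseteq> \<Psi>"
  shows "operator_noetherian scale \<Psi> L"
proof -
  have "operator_submodule scale \<Phi> U" if "operator_submodule scale \<Psi> U" for U
    using that assms(2) by (auto simp: operator_submodule_def)
  with assms(1) show ?thesis unfolding operator_noetherian_def by simp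
qed

lemma operator_submodule_Int:
  "operator_submodule scale \<Phi> U \<Longrightarrow> operator_submodule scale \<Phi> V \<Longrightarrow> operator_submodule scale \<Phi> (U \<inter> V)"
  by (simp add: operator_submodule_def subspace_inter)

text \<open>Noetherian induction: a failure of \<open>Q\<close> would give, by dependent choice, a
  strictly ascending chain of failures inside \<open>L\<close>.\<close>

lemma operator_noetherian_induct [consumes 3, case_names step]:
  assumes L: "operator_noetherian scale \<Phi> L" and N: "operator_submodule scale \<Phi> N" "N \<subseteq> L"
    and step: "\<And>N. operator_submodule scale \<Phi> N \<Longrightarrow> N \<subseteq> L \<Longrightarrow>
      (\<And>N'. operator_submodule scale \<Phi> N' \<Longrightarrow> N' \<subseteq> L \<Longrightarrow> N \<subset> N' \<Longrightarrow> Q N') \<Longrightarrow> Q N"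
  shows "Q N"
proof (rule ccontr)
  assume notQ: "\<not> Q N"
  have "\<exists>f. \<forall>j::nat. (operator_submodule scale \<Phi> (f j) \<and> f j \<subseteq> L \<and> \<not> Q (f j)) \<and> f j \<subset> f (Suc j)"
  proof (rule dependent_nat_choice)
    show "\<exists>N. operator_submodule scale \<Phi> N \<and> N \<subseteq> L \<and> \<not> Q N"
      using N notQ by (intro exI[of _ N] conjI)
    fix N assume "operator_submodule scale \<Phi> N \<and> N \<subseteq> L \<and> \<not> Q N"
    then show "\<exists>N'. (operator_submodule scale \<Phi> N' \<and> N' \<subseteq> L \<and> \<not> Q N') \<and> N \<subset> N'"
      using step[of N] by metis
  qed
  then obtain f where f: "\<And>j::nat. operator_submodule scale \<Phi> (f j)" "\<And>j. f j \<subseteq> L"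
    "\<And>j. f j \<subset> f (Suc j)" by metis
  have "incseq f" using psubset_imp_subset[OF f(3)] by (rule incseq_SucI)
  from operator_noetherianD[of _ _ f, OF L f(1,2) this] obtain c where c: "\<And>d. d \<ge> c \<Longrightarrow> f d = f c" by metis
  have "f (Suc c) = f c" by (rule c) simp
  with f(3)[of c] show False by simp
qed

section \<open>Hilbert's basis theorem for operators\<close>

text \<open>The diagonal stabilises at some \<open>c\<close>, which settles all rows from
  \<open>c\<close> on. The finitely many rows before \<open>c\<close> stabilise one by one, and
  \<open>C\<close> is the maximum of all these bounds.\<close>

lemma operator_noetherian_double_chain:
  fixes V :: "nat \<Rightarrow> nat \<Rightarrow> 'b set"
  assumes L: "operator_noetherian scale \<Phi> L"
    and V: "\<And>d j. operator_submodule scale \<Phi> (V d j)" "\<And>d j. V d j \<subseteq> L"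
    and mono: "\<And>d d' j j'. d \<le> d' \<Longrightarrow> j \<le> j' \<Longrightarrow> V d j \<subseteq> V d' j'"
  shows "\<exists>C. \<forall>d. \<forall>j\<ge>C. V d j = V d C"
proof -
  have "incseq (\<lambda>j. V j j)" by (auto simp: incseq_def intro: subsetD[OF mono])
  from operator_noetherianD[OF L V this] obtain c where c: "\<And>d. d \<ge> c \<Longrightarrow> V d d = V c c" by metis
  have "\<exists>e. \<forall>j\<ge>e. V d j = V d e" for d
  proof -
    have "incseq (V d)" by (auto simp: incseq_def intro: subsetD[OF mono])
    from operator_noetherianD[OF L V this] show ?thesis by metis
  qed
  then obtain e where e: "\<And>d j. j \<ge> e d \<Longrightarrow> V d j = V d (e d)" by metis
  define C where "C = Max (insert c (e ` {..<c}))"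
  have C: "c \<le> C" "\<And>d. d < c \<Longrightarrow> e d \<le> C" by (auto simp: C_def)
  have "V d j = V d C" if j: "j \<ge> C" for d j
  proof (cases "d < c")
    case True
    with e[of d j] e[of d C] C j show ?thesis by (metis order_trans)
  next
    case False
    \<comment> \<open>For \<open>d\<close> and \<open>i\<close> at least \<open>c\<close>, the entry
      lies between \<open>V c c\<close> and a later diagonal entry, and these two agree.\<close>
    have *: "V d i = V c c" if "i \<ge> c" for i
    proof
      show "V d i \<subseteq> V c c" using mono[of d "max d i" i "max d i"] c[of "max d i"] that by auto
      show "V c c \<subseteq> V d i" using False that by (intro mono) auto
    qed
    show ?thesis using *[of j] *[of C] C j by simp
  qed
  then show ?thesis by (intro exI allI impI)
qed

lemma module_hom_funpow: "module_hom scale scale x \<Longrightarrow> module_hom scale scale (x ^^ d)"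
proof (induction d)
  case (Suc d)
  then interpret x: module_hom scale scale x by simp
  interpret xd: module_hom scale scale "x ^^ d" by (rule Suc.IH[OF Suc.prems])
  show ?case by unfold_locales (simp_all add: xd.add xd.scale x.add x.scale)
qed (unfold_locales, simp_all)

text \<open>An operator that commutes with \<open>x\<close> acts on a polynomial in \<open>x\<close>
  coefficient by coefficient.\<close>

lemma operator_submodule_poly_part:
  assumes L: "operator_submodule scale \<Phi> L" and x: "module_hom scale scale x"
    and \<Phi>: "\<And>\<phi>. \<phi> \<in> \<Phi> \<Longrightarrow> module_hom scale scale \<phi>"
    and comm: "\<And>\<phi> u. \<phi> \<in> \<Phi> \<Longrightarrow> \<phi> (x u) = x (\<phi> u)"
  shows "operator_submodule scale \<Phi> (poly_part x L d)"
proof (induction d)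
  case 0
  show ?case using module_hom.zero[OF \<Phi>] by (simp add: operator_submodule_def)
next
  case (Suc d)
  interpret xd: module_hom scale scale "x ^^ d" by (rule module_hom_funpow[OF x])
  have comm': "\<phi> ((x ^^ d) u) = (x ^^ d) (\<phi> u)" if "\<phi> \<in> \<Phi>" for \<phi> u
    using comm[OF that] by (induction d) auto
  note sL = operator_submoduleD[OF L] and sP = operator_submoduleD[OF Suc]
  show ?case unfolding operator_submodule_def
  proof (intro conjI ballI subspaceI)
    show "0 \<in> poly_part x L (Suc d)"
      using subspace_0[OF sL(1)] subspace_0[OF sP(1)] xd.zero by force
  next
    fix u v assume "u \<in> poly_part x L (Suc d)" "v \<in> poly_part x L (Suc d)"
    then obtain a b a' b' where *: "u = (x ^^ d) a + b" "v = (x ^^ d) a' + b'"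
      "a \<in> L" "a' \<in> L" "b \<in> poly_part x L d" "b' \<in> poly_part x L d" by auto
    then have "u + v = (x ^^ d) (a + a') + (b + b')" by (simp add: xd.add algebra_simps)
    moreover have "a + a' \<in> L" "b + b' \<in> poly_part x L d"
      using * subspace_add[OF sL(1)] subspace_add[OF sP(1)] by auto
    ultimately show "u + v \<in> poly_part x L (Suc d)" unfolding poly_part.simps by blast
  next
    fix c u assume "u \<in> poly_part x L (Suc d)"
    then obtain a b where *: "u = (x ^^ d) a + b" "a \<in> L" "b \<in> poly_part x L d" by auto
    then have "c *s u = (x ^^ d) (c *s a) + c *s b" by (simp add: xd.scale algebra_simps)
    moreover have "c *s a \<in> L" "c *s b \<in> poly_part x L d"
      using * subspace_scale[OF sL(1)] subspace_scale[OF sP(1)] by auto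
    ultimately show "c *s u \<in> poly_part x L (Suc d)" unfolding poly_part.simps by blast
  next
    fix \<phi> u assume \<phi>: "\<phi> \<in> \<Phi>" and "u \<in> poly_part x L (Suc d)"
    then obtain a b where *: "u = (x ^^ d) a + b" "a \<in> L" "b \<in> poly_part x L d" by auto
    then have "\<phi> u = (x ^^ d) (\<phi> a) + \<phi> b" by (simp add: module_hom.add[OF \<Phi>[OF \<phi>]] comm'[OF \<phi>])
    moreover have "\<phi> a \<in> L" "\<phi> b \<in> poly_part x L d"
      using * sL(2)[OF \<phi>] sP(2)[OF \<phi>] by auto
    ultimately show "\<phi> u \<in> poly_part x L (Suc d)" unfolding poly_part.simps by blast
  qed
qed

text \<open>Hilbert's basis theorem: chains of submodules of the sum of all \<open>x\<^sup>d L\<close> are controlled by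
  their modules of leading coefficients.\<close>

lemma operator_noetherian_adjoin:
  assumes L: "operator_submodule scale \<Phi> L" "operator_noetherian scale \<Phi> L" and x: "module_hom scale scale x"
    and \<Phi>: "\<And>\<phi>. \<phi> \<in> \<Phi> \<Longrightarrow> module_hom scale scale \<phi>"
    and comm: "\<And>\<phi> u. \<phi> \<in> \<Phi> \<Longrightarrow> \<phi> (x u) = x (\<phi> u)"
  shows "\<exists>L'. L \<subseteq> L' \<and> operator_submodule scale (insert x \<Phi>) L' \<and> operator_noetherian scale (insert x \<Phi>) L'"
proof (intro exI conjI)
  let ?D = "poly_part x L"
  define L' where "L' = (\<Union>d. ?D d)"
  interpret x: module_hom scale scale x by (rule x)
  interpret xd: module_hom scale scale "x ^^ d" for d by (rule module_hom_funpow[OF x])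
  have sD: "operator_submodule scale \<Phi> (?D d)" for d
    by (rule operator_submodule_poly_part[OF L(1) x \<Phi> comm])
  note sL = operator_submoduleD[OF L(1)] and sD' = operator_submoduleD[OF sD]
  have comm': "\<phi> ((x ^^ d) u) = (x ^^ d) (\<phi> u)" if "\<phi> \<in> \<Phi>" for \<phi> u d
    using comm[OF that] by (induction d) auto
  have D_Suc: "?D d \<subseteq> ?D (Suc d)" for d
    using subspace_0[OF sL(1)] xd.zero[of d] by force
  have D_mono: "?D d \<subseteq> ?D d'" if "d \<le> d'" for d d'
    by (rule lift_Suc_mono_le[of ?D, OF D_Suc that])
  have x_D: "x u \<in> ?D (Suc d)" if "u \<in> ?D d" for u d
    using that
  proof (induction d arbitrary: u)
    case 0
    then show ?case using subspace_0[OF sL(1)] x.zero by force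
  next
    case (Suc d)
    then obtain a b where *: "u = (x ^^ d) a + b" "a \<in> L" "b \<in> ?D d" by auto
    then have "x u = (x ^^ Suc d) a + x b" by (simp add: x.add)
    moreover have "x b \<in> ?D (Suc d)" by (rule Suc.IH[OF *(3)])
    ultimately show ?case using *(2) poly_part.simps(2)[of x L "Suc d"] by blast
  qed
  show "L \<subseteq> L'"
    by (auto simp: L'_def intro!: exI[of _ 1])
  have "subspace L'"
  proof (rule subspaceI)
    show "0 \<in> L'" by (auto simp: L'_def intro!: exI[of _ 0])
    fix u v assume "u \<in> L'" "v \<in> L'"
    then obtain i j where "u \<in> ?D i" "v \<in> ?D j" by (auto simp: L'_def)
    then have "u \<in> ?D (max i j)" "v \<in> ?D (max i j)"
      using D_mono[of i "max i j"] D_mono[of j "max i j"] by auto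
    then show "u + v \<in> L'" using subspace_add[OF sD'(1)] by (auto simp: L'_def)
  next
    fix c u assume "u \<in> L'"
    then obtain d where "u \<in> ?D d" by (auto simp: L'_def)
    then have "c *s u \<in> ?D d" by (rule subspace_scale[OF sD'(1)])
    then show "c *s u \<in> L'" by (auto simp: L'_def)
  qed
  moreover have "\<phi> u \<in> L'" if "\<phi> \<in> insert x \<Phi>" "u \<in> L'" for \<phi> u
  proof -
    from that(2) obtain d where d: "u \<in> ?D d" by (auto simp: L'_def)
    have "\<phi> u \<in> ?D d \<union> ?D (Suc d)" using that(1) x_D[OF d] sD'(2)[OF _ d] by auto
    then show ?thesis unfolding L'_def by blast
  qed
  ultimately show "operator_submodule scale (insert x \<Phi>) L'"
    by (simp add: operator_submodule_def)
  show "operator_noetherian scale (insert x \<Phi>) L'"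
    unfolding operator_noetherian_def
  proof (intro allI impI, elim conjE)
    fix U :: "nat \<Rightarrow> 'b set"
    assume U: "\<forall>j. operator_submodule scale (insert x \<Phi>) (U j) \<and> U j \<subseteq> L'" and incU: "incseq U"
    then have sU: "subspace (U j)" "\<And>\<phi> u. \<phi> \<in> \<Phi> \<Longrightarrow> u \<in> U j \<Longrightarrow> \<phi> u \<in> U j"
      "\<And>u. u \<in> U j \<Longrightarrow> x u \<in> U j" for j
      by (auto simp: operator_submodule_def)
    \<comment> \<open>The coefficients at \<open>x ^^ d\<close> of elements of \<open>U j\<close>,
      over all expressions of such elements as polynomials of degree at most \<open>d\<close>;
      \<open>?D d\<close> supplies the terms of lower degree.\<close>
    define V where "V d j = {a \<in> L. \<exists>b \<in> ?D d. (x ^^ d) a + b \<in> U j}" for d j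
    have VI: "a \<in> V d j" if "a \<in> L" "b \<in> ?D d" "(x ^^ d) a + b \<in> U j" for a b d j
      using that by (auto simp: V_def)
    have V: "operator_submodule scale \<Phi> (V d j)" for d j
      unfolding operator_submodule_def
    proof (intro conjI ballI subspaceI)
      show "0 \<in> V d j"
        using subspace_0[OF sL(1)] subspace_0[OF sD'(1)] subspace_0[OF sU(1)]
        by (auto simp: V_def xd.zero intro!: bexI[of _ 0])
    next
      fix a a' assume "a \<in> V d j" "a' \<in> V d j"
      then obtain b b' where *: "a \<in> L" "a' \<in> L" "b \<in> ?D d" "b' \<in> ?D d"
        "(x ^^ d) a + b \<in> U j" "(x ^^ d) a' + b' \<in> U j" by (auto simp: V_def)
      have "(x ^^ d) (a + a') + (b + b') \<in> U j"
        using subspace_add[OF sU(1) *(5,6)] by (simp add: xd.add algebra_simps)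
      then show "a + a' \<in> V d j"
        by (rule VI[OF subspace_add[OF sL(1) *(1,2)] subspace_add[OF sD'(1) *(3,4)]])
    next
      fix c a assume "a \<in> V d j"
      then obtain b where *: "a \<in> L" "b \<in> ?D d" "(x ^^ d) a + b \<in> U j" by (auto simp: V_def)
      have "(x ^^ d) (c *s a) + c *s b \<in> U j"
        using subspace_scale[OF sU(1) *(3), of c] by (simp add: xd.scale algebra_simps)
      then show "c *s a \<in> V d j"
        by (rule VI[OF subspace_scale[OF sL(1) *(1)] subspace_scale[OF sD'(1) *(2)]])
    next
      fix \<phi> a assume \<phi>: "\<phi> \<in> \<Phi>" and "a \<in> V d j"
      then obtain b where *: "a \<in> L" "b \<in> ?D d" "(x ^^ d) a + b \<in> U j" by (auto simp: V_def)
      have "(x ^^ d) (\<phi> a) + \<phi> b \<in> U j"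
        using sU(2)[OF \<phi> *(3)] by (simp add: module_hom.add[OF \<Phi>[OF \<phi>]] comm'[OF \<phi>])
      then show "\<phi> a \<in> V d j"
        by (rule VI[OF sL(2)[OF \<phi> *(1)] sD'(2)[OF \<phi> *(2)]])
    qed
    \<comment> \<open>Applying \<open>x\<close> raises the degree and keeps the leading coefficient,
      so \<open>V\<close> ascends in \<open>d\<close> as well as in \<open>j\<close>.\<close>
    have V_Suc: "V d j \<subseteq> V (Suc d) j" for d j
    proof
      fix a assume "a \<in> V d j"
      then obtain b where *: "a \<in> L" "b \<in> ?D d" "(x ^^ d) a + b \<in> U j" by (auto simp: V_def)
      then have "(x ^^ Suc d) a + x b \<in> U j" using sU(3)[OF *(3)] by (simp add: x.add)
      then show "a \<in> V (Suc d) j" by (rule VI[OF *(1) x_D[OF *(2)]])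
    qed
    have V_mono: "V d j \<subseteq> V d' j'" if "d \<le> d'" "j \<le> j'" for d d' j j'
    proof -
      have "V d j \<subseteq> V d' j" by (rule lift_Suc_mono_le[of "\<lambda>d. V d j", OF V_Suc that(1)])
      also have "V d' j \<subseteq> V d' j'" using incseqD[OF incU that(2)] by (auto simp: V_def)
      finally show ?thesis .
    qed
    have V_L: "V d j \<subseteq> L" for d j by (auto simp: V_def)
    \<comment> \<open>The double chain gives one \<open>C\<close> for all degrees; separate bounds
      for each degree would not suffice.\<close>
    obtain C where C: "\<And>d j. j \<ge> C \<Longrightarrow> V d j = V d C"
      using operator_noetherian_double_chain[where V = V, OF L(2) V V_L V_mono] by metis
    have "U j = U C" if j: "j \<ge> C" for j
    proof
      show "U C \<subseteq> U j" using incseqD[OF incU j] .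
      \<comment> \<open>Induction on the degree: subtracting an element of \<open>U C\<close> with
        the same leading coefficient leaves an element of \<open>U j\<close> of smaller
        degree.\<close>
      have "u \<in> U C" if "u \<in> ?D d" "u \<in> U j" for d u
        using that
      proof (induction d arbitrary: u)
        case 0
        then show ?case using subspace_0[OF sU(1)] by simp
      next
        case (Suc d)
        then obtain a b where *: "u = (x ^^ d) a + b" "a \<in> L" "b \<in> ?D d" by auto
        with Suc.prems have "a \<in> V d j" using VI by simp
        then have "a \<in> V d C" unfolding C[OF j] .
        then obtain b' where b': "b' \<in> ?D d" "(x ^^ d) a + b' \<in> U C" by (auto simp: V_def)
        have "u - ((x ^^ d) a + b') \<in> U j"
          using subspace_diff[OF sU(1) Suc.prems(2)] b'(2) \<open>U C \<subseteq> U j\<close> by blast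
        then have "b - b' \<in> U j" using * by simp
        then have "b - b' \<in> U C" by (rule Suc.IH[OF subspace_diff[OF sD'(1) *(3) b'(1)]])
        from subspace_add[OF sU(1) this b'(2)] show ?case using *(1) by (simp add: algebra_simps)
      qed
      moreover have "\<exists>d. u \<in> ?D d" if "u \<in> U j" for u using U that by (auto simp: L'_def)
      ultimately show "U j \<subseteq> U C" by (meson subsetI)
    qed
    then show "\<exists>c. \<forall>d\<ge>c. U d = U c" by (intro exI allI impI)
  qed
qed

text \<open>Commuting operators are adjoined one at a time, like the variables of a polynomial
  ring.\<close>

lemma operator_noetherian_adjoin_finite:
  assumes "finite \<Psi>" and L: "subspace L" "operator_noetherian scale {} L"
    and \<Psi>: "\<And>\<phi>. \<phi> \<in> \<Psi> \<Longrightarrow> module_hom scale scale \<phi>"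
    and comm: "\<And>\<phi> \<psi> u. \<phi> \<in> \<Psi> \<Longrightarrow> \<psi> \<in> \<Psi> \<Longrightarrow> \<phi> (\<psi> u) = \<psi> (\<phi> u)"
  shows "\<exists>L'. L \<subseteq> L' \<and> operator_submodule scale \<Psi> L' \<and> operator_noetherian scale \<Psi> L'"
  using assms(1) \<Psi> comm
proof (induction \<Psi> rule: finite_induct)
  case empty
  then show ?case using L by (auto simp: operator_submodule_def)
next
  case (insert x \<Psi>)
  have "\<exists>L'. L \<subseteq> L' \<and> operator_submodule scale \<Psi> L' \<and> operator_noetherian scale \<Psi> L'"
    by (rule insert.IH) (simp_all add: insert.prems)
  then obtain L1 where L1: "L \<subseteq> L1" "operator_submodule scale \<Psi> L1" "operator_noetherian scale \<Psi> L1"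
    by auto
  have "\<exists>L'. L1 \<subseteq> L' \<and> operator_submodule scale (insert x \<Psi>) L' \<and> operator_noetherian scale (insert x \<Psi>) L'"
    by (rule operator_noetherian_adjoin[OF L1(2,3)]) (simp_all add: insert.prems)
  then obtain L' where "L1 \<subseteq> L'" "operator_submodule scale (insert x \<Psi>) L'"
    "operator_noetherian scale (insert x \<Psi>) L'" by auto
  with L1(1) show ?case by (intro exI[of _ L'] conjI) auto
qed

text \<open>Induction on the generators: a chain in the span of \<open>insert s S\<close> is
  controlled by its intersections with \<open>span S\<close> and by the ideals \<open>K j\<close> of
  coefficients of \<open>s\<close> modulo \<open>span S\<close>.\<close>

lemma operator_noetherian_span:
  assumes R: "noetherian_ring TYPE('a)" and "finite S"
  shows "operator_noetherian scale {} (span S)"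
  using assms(2)
proof (induction S rule: finite_induct)
  case empty
  have "U = {0}" if "operator_submodule scale {} U" "U \<subseteq> {0}" for U
    using that subspace_0 by (auto simp: operator_submodule_def)
  then show ?case unfolding operator_noetherian_def by (metis span_empty)
next
  case (insert s S)
  show ?case unfolding operator_noetherian_def
  proof (intro allI impI, elim conjE)
    fix U :: "nat \<Rightarrow> 'b set"
    assume U: "\<forall>j. operator_submodule scale {} (U j) \<and> U j \<subseteq> span (insert s S)" and incU: "incseq U"
    then have sU: "subspace (U j)" for j by (simp add: operator_submodule_def)
    define K where "K j = {k. \<exists>u \<in> U j. u - k *s s \<in> span S}" for j
    have K: "ideal (K j)" for j
      unfolding ideal_iff
    proof (intro conjI ballI allI)
      show "0 \<in> K j" using subspace_0[OF sU] span_zero by (force simp: K_def)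
    next
      fix k l assume "k \<in> K j" "l \<in> K j"
      then obtain u v where *: "u \<in> U j" "v \<in> U j" "u - k *s s \<in> span S" "v - l *s s \<in> span S"
        by (auto simp: K_def)
      have "(u + v) - (k + l) *s s \<in> span S"
        using span_add[OF *(3,4)] by (simp add: algebra_simps)
      with subspace_add[OF sU *(1,2)] show "k + l \<in> K j" unfolding K_def by blast
    next
      fix c k assume "k \<in> K j"
      then obtain u where *: "u \<in> U j" "u - k *s s \<in> span S" by (auto simp: K_def)
      have "c *s u - (c * k) *s s \<in> span S"
        using span_scale[OF *(2), of c] by (simp add: algebra_simps)
      with subspace_scale[OF sU *(1)] show "c * k \<in> K j" unfolding K_def by blast
    qed
    have "incseq K" using incU unfolding incseq_def K_def by blast
    from noetherian_ring_acc[of K, OF R K this] obtain c where c: "\<And>d. d \<ge> c \<Longrightarrow> K d = K c" by metis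
    have "incseq (\<lambda>j. U j \<inter> span S)" using incU unfolding incseq_def by blast
    then obtain e where e: "\<And>d. d \<ge> e \<Longrightarrow> U d \<inter> span S = U e \<inter> span S"
      using operator_noetherianD[OF insert.IH, of "\<lambda>j. U j \<inter> span S"] sU
      by (auto simp: operator_submodule_def subspace_inter)
    let ?C = "max c e"
    have "U j = U ?C" if j: "j \<ge> ?C" for j
    proof
      show "U ?C \<subseteq> U j" using incseqD[OF incU j] .
      show "U j \<subseteq> U ?C"
      proof
        fix u assume u: "u \<in> U j"
        then obtain k where k: "u - k *s s \<in> span S" using U span_insert by blast
        with u have "k \<in> K j" by (auto simp: K_def)
        then have "k \<in> K ?C" using c[of j] c[of ?C] j by simp
        then obtain v where v: "v \<in> U ?C" "v - k *s s \<in> span S" by (auto simp: K_def)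
        have "u - v \<in> span S" using span_diff[OF k v(2)] by simp
        moreover have "u - v \<in> U j" using subspace_diff[OF sU u] v(1) \<open>U ?C \<subseteq> U j\<close> by blast
        ultimately have "u - v \<in> U ?C" using e[of j] e[of ?C] j by auto
        from subspace_add[OF sU this v(1)] show "u \<in> U ?C" by simp
      qed
    qed
    then show "\<exists>c. \<forall>d\<ge>c. U d = U c" by (intro exI allI impI)
  qed
qed

text \<open>The induction passes from \<open>N\<close> to \<open>N : P\<close> for a maximal annihilator \<open>P = N : u\<close> with \<open>u\<close> not in \<open>N\<close>.\<close>

lemma finite_ideals_for_saturation:
  assumes R: "noetherian_ring TYPE('a)"
    and L: "operator_submodule scale \<Phi> L" "operator_noetherian scale \<Phi> L"
    and \<Phi>: "\<And>\<phi>. \<phi> \<in> \<Phi> \<Longrightarrow> module_hom scale scale \<phi>"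
    and N: "operator_submodule scale \<Phi> N" "N \<subseteq> L"
  shows "\<exists>F r. finite F \<and> (\<forall>J'\<in>F. ideal J') \<and> (\<forall>J. ideal J \<longrightarrow> (\<exists>J'\<in>F. J \<subseteq> J' \<and>
    (\<forall>u\<in>L. \<forall>m. u \<in> colon scale N (ideal_pow J m) \<longrightarrow> u \<in> colon scale N (ideal_pow J' r))))"
  using L(2) N
proof (induction rule: operator_noetherian_induct)
  case (step N)
  note N = step.hyps
  have sL: "subspace L" using L(1) operator_submoduleD by blast
  show ?case
  proof (cases "N = L")
    case True
    then show ?thesis
      using sL by (intro exI[of _ "{UNIV}"] exI[of _ 0]) (auto simp: colon_def subspace_scale)
  next
    case False
    have sN: "subspace N" using N operator_submoduleD by blast
    define ann where "ann u = {a. a *s u \<in> N}" for u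
    have ideal_ann: "ideal (ann u)" for u
      unfolding ann_def using sN by (rule ideal_scale_vimage)
    from False obtain u0 where "u0 \<in> L - N" using N by blast
    then have "ann u0 \<in> ann ` (L - N)" by (rule imageI)
    moreover have "ideal K" if "K \<in> ann ` (L - N)" for K using that ideal_ann by auto
    ultimately have "\<exists>P \<in> ann ` (L - N). \<forall>K \<in> ann ` (L - N). P \<subseteq> K \<longrightarrow> K = P"
      by (intro noetherian_ring_maximal[OF R])
    then obtain u where u: "u \<in> L - N"
      and max: "\<And>v. v \<in> L - N \<Longrightarrow> ann u \<subseteq> ann v \<Longrightarrow> ann v = ann u"
      unfolding ball_simps bex_simps by metis
    define P where "P = ann u"
    define N' where "N' = {v \<in> L. \<forall>a\<in>P. a *s v \<in> N}"
    have "N' = L \<inter> colon scale N P" by (auto simp: N'_def colon_def)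
    then have sN': "subspace N'" using subspace_inter[OF sL subspace_colon[OF sN]] by simp
    have N'op: "operator_submodule scale \<Phi> N'"
      unfolding operator_submodule_def
    proof (intro conjI ballI sN')
      fix \<phi> v assume \<phi>: "\<phi> \<in> \<Phi>" and v: "v \<in> N'"
      have "a *s \<phi> v \<in> N" if "a \<in> P" for a
      proof -
        have "\<phi> (a *s v) \<in> N"
          using v that operator_submoduleD(2)[OF N(1) \<phi>] by (simp add: N'_def)
        then show ?thesis by (simp add: module_hom.scale[OF \<Phi>[OF \<phi>]])
      qed
      then show "\<phi> v \<in> N'" using v operator_submoduleD(2)[OF L(1) \<phi>] by (simp add: N'_def)
    qed
    have "N \<subset> N'"
      using u N(2) subspace_scale[OF sN] by (auto simp: N'_def P_def ann_def)
    \<comment> \<open>For \<open>b\<close> in \<open>J\<close>, take the last multiple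
      \<open>b ^ k *s v\<close> outside \<open>N\<close>. Its annihilator modulo \<open>N\<close>
      contains \<open>P\<close>, hence equals \<open>P\<close> by maximality, and it contains
      \<open>b\<close>.\<close>
    have JP: "J \<subseteq> P" if J: "v \<in> N'" "v \<notin> N" "v \<in> colon scale N (ideal_pow J m)" for J v m
    proof
      fix b assume "b \<in> J"
      then have "b ^ m *s v \<in> N" using J(3) power_mem_ideal_pow by (auto simp: colon_def)
      define l where "l = (LEAST l. b ^ l *s v \<in> N)"
      have l: "b ^ l *s v \<in> N" unfolding l_def by (rule LeastI) fact
      have "l \<noteq> 0"
      proof
        assume "l = 0"
        with l J(2) show False by simp
      qed
      then obtain k where k: "l = Suc k" using not0_implies_Suc by blast
      let ?w = "b ^ k *s v"
      have "?w \<notin> N" using not_less_Least[of k "\<lambda>l. b ^ l *s v \<in> N"] k l_def by auto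
      moreover have "?w \<in> L" using J(1) subspace_scale[OF sL] by (auto simp: N'_def)
      moreover have "P \<subseteq> ann ?w"
      proof
        fix a assume "a \<in> P"
        then have "a *s v \<in> N" using J(1) by (simp add: N'_def)
        from subspace_scale[OF sN this, of "b ^ k"] show "a \<in> ann ?w"
          by (simp add: ann_def mult.commute)
      qed
      ultimately have "ann ?w = P" using max P_def by blast
      moreover have "b \<in> ann ?w" using l k by (simp add: ann_def)
      ultimately show "b \<in> P" by simp
    qed
    have "N' \<subseteq> L" by (auto simp: N'_def)
    obtain F r where F: "finite F" "\<And>J'. J' \<in> F \<Longrightarrow> ideal J'"
      and Fr: "\<And>J. ideal J \<Longrightarrow> \<exists>J'\<in>F. J \<subseteq> J' \<and> (\<forall>u\<in>L. \<forall>m.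
        u \<in> colon scale N' (ideal_pow J m) \<longrightarrow> u \<in> colon scale N' (ideal_pow J' r))"
      using step.IH[OF N'op \<open>N' \<subseteq> L\<close> \<open>N \<subset> N'\<close>] by metis
    show ?thesis
    \<comment> \<open>The ideals \<open>J'\<close> found for \<open>N'\<close> serve when
      \<open>J\<close> is not inside \<open>P\<close>; otherwise \<open>P \<inter> J'\<close> is
      taken. The exponent grows by one because a further factor from \<open>P\<close> is needed to
      get from \<open>N'\<close> into \<open>N\<close>.\<close>
    proof (rule exI[of _ "F \<union> (\<lambda>J'. P \<inter> J') ` F"], rule exI[of _ "Suc r"], intro conjI allI impI)
      show "finite (F \<union> (\<lambda>J'. P \<inter> J') ` F)" using F by simp
      show "\<forall>J'\<in>F \<union> (\<lambda>J'. P \<inter> J') ` F. ideal J'"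
        using F ideal_ann[of u] by (auto simp: P_def intro: ideal_Int)
      fix J :: "'a set" assume "ideal J"
      from Fr[OF this] obtain J' where J': "J' \<in> F" "J \<subseteq> J'"
        and *: "\<And>u m. u \<in> L \<Longrightarrow> u \<in> colon scale N' (ideal_pow J m) \<Longrightarrow> u \<in> colon scale N' (ideal_pow J' r)"
        by blast
      have **: "v \<in> colon scale N' (ideal_pow J' r)"
        if "v \<in> L" "v \<in> colon scale N (ideal_pow J m)" for v m
        using *[OF that(1)] that(2) colon_mono[OF psubset_imp_subset[OF \<open>N \<subset> N'\<close>]] by blast
      show "\<exists>J'\<in>F \<union> (\<lambda>J'. P \<inter> J') ` F. J \<subseteq> J' \<and> (\<forall>u\<in>L. \<forall>m.
        u \<in> colon scale N (ideal_pow J m) \<longrightarrow> u \<in> colon scale N (ideal_pow J' (Suc r)))"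
      proof (cases "J \<subseteq> P")
        case True
        have "v \<in> colon scale N (ideal_pow (P \<inter> J') (Suc r))"
          if v: "v \<in> L" "v \<in> colon scale N (ideal_pow J m)" for v m
        proof -
          have "ideal_pow (P \<inter> J') (Suc r) \<subseteq> ann v"
            unfolding ideal_pow.simps
          proof (rule ideal_prod_minimal[OF ideal_ann])
            fix a b assume a: "a \<in> P \<inter> J'" and "b \<in> ideal_pow (P \<inter> J') r"
            then have "b \<in> ideal_pow J' r" using ideal_pow_mono[of "P \<inter> J'" J' r] by blast
            then have "b *s v \<in> N'" using **[OF v] by (simp add: colon_def)
            with a have "a *s b *s v \<in> N" by (simp add: N'_def del: scale_scale)
            then show "a * b \<in> ann v" by (simp add: ann_def)
          qed
          then show ?thesis by (auto simp: colon_def ann_def)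
        qed
        moreover have "P \<inter> J' \<in> F \<union> (\<lambda>J'. P \<inter> J') ` F" "J \<subseteq> P \<inter> J'" using J' True by auto
        ultimately show ?thesis by meson
      next
        case False
        have "v \<in> colon scale N (ideal_pow J' (Suc r))"
          if v: "v \<in> L" "v \<in> colon scale N (ideal_pow J m)" for v m
        proof -
          \<comment> \<open>Here \<open>J'^r\<close> sends \<open>v\<close> into \<open>N\<close> at
            once: a multiple left in \<open>N'\<close> but outside \<open>N\<close> would force
            \<open>J \<subseteq> P\<close> by \<open>JP\<close>.\<close>
          have "b *s v \<in> N" if "b \<in> ideal_pow J' r" for b
          proof (rule ccontr)
            assume "b *s v \<notin> N"
            moreover have "b *s v \<in> N'" using **[OF v] that by (simp add: colon_def)
            moreover have "b *s v \<in> colon scale N (ideal_pow J m)" by (rule colon_scale[OF sN v(2)])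
            ultimately show False using JP False by blast
          qed
          then have "v \<in> colon scale N (ideal_pow J' r)" by (simp add: colon_def)
          then show ?thesis
            by (rule subsetD[OF colon_antimono[OF ideal_pow_antimono[OF le_SucI[OF order_refl]]]])
        qed
        with J' show ?thesis by (meson UnI1)
      qed
    qed
  qed
qed

end

section \<open>The Rees module\<close>

text \<open>The Rees module is realised inside the functions from multi-indices to \<open>M\<close>;
  this is the monomial \<open>u T^n\<close>. Multi-indices are functions on all naturals, and the
  relevant ones vanish from \<open>t\<close> on.\<close>

definition homogeneous :: "(nat \<Rightarrow> nat) \<Rightarrow> 'm::zero \<Rightarrow> (nat \<Rightarrow> nat) \<Rightarrow> 'm" where
  "homogeneous n u = (\<lambda>m. if m = n then u else 0)"

definition pointwise :: "('a \<Rightarrow> 'm \<Rightarrow> 'm) \<Rightarrow> 'a \<Rightarrow> ((nat \<Rightarrow> nat) \<Rightarrow> 'm) \<Rightarrow> (nat \<Rightarrow> nat) \<Rightarrow> 'm" where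
  "pointwise scale a f = (\<lambda>n. scale a (f n))"

text \<open>Multiplication by \<open>a T\<^sub>i\<close>.\<close>

definition shift ::
    "('a \<Rightarrow> 'm \<Rightarrow> 'm) \<Rightarrow> 'a \<Rightarrow> nat \<Rightarrow> ((nat \<Rightarrow> nat) \<Rightarrow> 'm) \<Rightarrow> (nat \<Rightarrow> nat) \<Rightarrow> 'm::zero" where
  "shift scale a i f = (\<lambda>n. if n i = 0 then 0 else scale a (f (n(i := n i - 1))))"

definition shifts ::
    "('a \<Rightarrow> 'm \<Rightarrow> 'm) \<Rightarrow> (nat \<Rightarrow> 'a set) \<Rightarrow> nat \<Rightarrow> (((nat \<Rightarrow> nat) \<Rightarrow> 'm) \<Rightarrow> (nat \<Rightarrow> nat) \<Rightarrow> 'm::zero) set" where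
  "shifts scale I t = (\<Union>i<t. (\<lambda>a. shift scale a i) ` I i)"

context module
begin

lemma module_pointwise: "module (pointwise scale)"
  by unfold_locales (auto simp: pointwise_def algebra_simps fun_eq_iff)

lemma module_hom_shift: "module_hom (pointwise scale) (pointwise scale) (shift scale a i)"
proof -
  interpret P: module "pointwise scale" by (rule module_pointwise)
  show ?thesis
    by unfold_locales (auto simp: pointwise_def shift_def algebra_simps fun_eq_iff)
qed

lemma shift_commute: "shift scale a i (shift scale b j f) = shift scale b j (shift scale a i f)"
  by (cases "i = j") (auto simp: shift_def fun_eq_iff mult.commute fun_upd_twist)

lemma shift_homogeneous:
  "shift scale a i (homogeneous n u) = homogeneous (n(i := Suc (n i))) (a *s u)"
proof
  fix m
  have "m i \<noteq> 0 \<and> m(i := m i - 1) = n \<longleftrightarrow> m = n(i := Suc (n i))"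
    by (auto simp: fun_eq_iff split: if_splits)
  then show "shift scale a i (homogeneous n u) m = homogeneous (n(i := Suc (n i))) (a *s u) m"
    by (auto simp: shift_def homogeneous_def)
qed

lemma homogeneous_add: "homogeneous n (u + v :: 'b) = homogeneous n u + homogeneous n v"
  by (auto simp: homogeneous_def fun_eq_iff)

lemma homogeneous_scale: "homogeneous n (a *s u) = pointwise scale a (homogeneous n u)"
  by (auto simp: homogeneous_def pointwise_def fun_eq_iff)

lemma homogeneous_zero: "homogeneous n 0 = 0"
  by (auto simp: homogeneous_def fun_eq_iff)

lemma subspace_homogeneous_vimage:
  assumes "module.subspace (pointwise scale) U"
  shows "subspace {u. homogeneous n u \<in> U}"
proof -
  interpret P: module "pointwise scale" by (rule module_pointwise)
  show ?thesis
    using P.subspace_0[OF assms] P.subspace_add[OF assms] P.subspace_scale[OF assms]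
    by (intro subspaceI) (simp_all add: homogeneous_add homogeneous_scale homogeneous_zero)
qed

lemma ideal_smult_ideal_smult_subset:
  "ideal_smult scale J (ideal_smult scale I N) \<subseteq> ideal_smult scale (ideal_prod I J) N"
proof (rule ideal_smult_minimal[OF subspace_ideal_smult])
  fix a x assume a: "a \<in> J" and x: "x \<in> ideal_smult scale I N"
  have "ideal_smult scale I N \<subseteq> {x. a *s x \<in> ideal_smult scale (ideal_prod I J) N}"
  proof (rule ideal_smult_minimal[OF subspace_scale_vimage[OF subspace_ideal_smult]])
    fix b y assume "b \<in> I" "y \<in> N"
    then have "(b * a) *s y \<in> ideal_smult scale (ideal_prod I J) N"
      by (intro ideal_smult_mem ideal_prod_mem a)
    then show "b *s y \<in> {x. a *s x \<in> ideal_smult scale (ideal_prod I J) N}"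
      by (simp add: mult.commute)
  qed
  with x show "a *s x \<in> ideal_smult scale (ideal_prod I J) N" by blast
qed

text \<open>The copy \<open>L0\<close> of \<open>M\<close> in degree zero is noetherian, and the
  finitely many shifts by generators of the ideals are adjoined to it. The conclusion records that
  \<open>L\<close> contains all monomials of the Rees module, which is how it is entered
  later.\<close>

lemma Rees_module_noetherian:
  assumes R: "noetherian_ring TYPE('a)" and fg: "fin_gen_module scale"
    and I: "\<And>i. i < t \<Longrightarrow> ideal (I i)"
  shows "\<exists>L. operator_submodule (pointwise scale) (shifts scale I t) L \<and>
    operator_noetherian (pointwise scale) (shifts scale I t) L \<and>
    (\<forall>n u. (\<forall>i\<ge>t. n i = 0) \<longrightarrow> u \<in> ideal_smult scale (ideal_multipow I n t) UNIV \<longrightarrow>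
      homogeneous n u \<in> L)"
proof -
  interpret P: module "pointwise scale" by (rule module_pointwise)
  have "\<exists>S. finite S \<and> I i = ideal_span S" if "i < t" for i
    using R I[OF that] unfolding noetherian_ring_def by simp
  then have "\<forall>i\<in>{..<t}. \<exists>S. finite S \<and> I i = ideal_span S" by simp
  from bchoice[OF this] obtain S
    where S: "\<And>i. i < t \<Longrightarrow> finite (S i)" "\<And>i. i < t \<Longrightarrow> I i = ideal_span (S i)"
    by auto
  define L0 where "L0 = range (homogeneous (\<lambda>_. 0) :: 'b \<Rightarrow> (nat \<Rightarrow> nat) \<Rightarrow> 'b)"
  have L0: "P.subspace L0"
  proof (rule P.subspaceI)
    show "0 \<in> L0" unfolding L0_def by (subst homogeneous_zero[symmetric]) (rule rangeI)
  next
    fix f g assume "f \<in> L0" "g \<in> L0"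
    then show "f + g \<in> L0" by (auto simp: L0_def simp flip: homogeneous_add)
  next
    fix c f assume "f \<in> L0"
    then show "pointwise scale c f \<in> L0" by (auto simp: L0_def simp flip: homogeneous_scale)
  qed
  have L0_noeth: "operator_noetherian (pointwise scale) {} L0"
    unfolding operator_noetherian_def
  proof (intro allI impI, elim conjE)
    fix U :: "nat \<Rightarrow> ((nat \<Rightarrow> nat) \<Rightarrow> 'b) set"
    assume U: "\<forall>j. operator_submodule (pointwise scale) {} (U j) \<and> U j \<subseteq> L0" and incU: "incseq U"
    \<comment> \<open>The chain in degree zero is read back as a chain of submodules of
      \<open>M\<close>.\<close>
    define W where "W j = {u. homogeneous (\<lambda>_. 0) u \<in> U j}" for j
    have UW: "U j = homogeneous (\<lambda>_. 0) ` W j" for j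
      using U unfolding W_def L0_def by blast
    have W: "operator_submodule scale {} (W j)" for j
      using U unfolding W_def operator_submodule_def by (simp add: subspace_homogeneous_vimage)
    have "incseq W" using incU unfolding incseq_def W_def by blast
    obtain B where B: "finite B" "span B = UNIV" using fg unfolding fin_gen_module_def by blast
    then have M: "operator_noetherian scale {} UNIV" using operator_noetherian_span[OF R B(1)] by simp
    obtain c where c: "\<And>d. d \<ge> c \<Longrightarrow> W d = W c"
      using operator_noetherianD[where U = W, OF M W subset_UNIV \<open>incseq W\<close>] by metis
    have "U d = U c" if "d \<ge> c" for d unfolding UW c[OF that] by (rule refl)
    then show "\<exists>c. \<forall>d\<ge>c. U d = U c" by (intro exI allI impI)
  qed
  have fin: "finite (shifts scale S t)" unfolding shifts_def using S(1) by auto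
  have "\<exists>L. L0 \<subseteq> L \<and> operator_submodule (pointwise scale) (shifts scale S t) L \<and>
      operator_noetherian (pointwise scale) (shifts scale S t) L"
    by (rule P.operator_noetherian_adjoin_finite[OF fin L0 L0_noeth])
      (auto simp: shifts_def module_hom_shift shift_commute)
  then obtain L where L: "L0 \<subseteq> L" "operator_submodule (pointwise scale) (shifts scale S t) L"
      "operator_noetherian (pointwise scale) (shifts scale S t) L" by metis
  have sL: "P.subspace L" using P.operator_submoduleD(1)[OF L(2)] .
  \<comment> \<open>A shift is linear in its coefficient \<open>a\<close>, so stability under
    generators of \<open>I i\<close> extends to all of \<open>I i\<close>.\<close>
  have shift_L: "shift scale a i f \<in> L" if "i < t" "a \<in> I i" "f \<in> L" for a i f
  proof -
    have "ideal_span (S i) \<subseteq> {a. shift scale a i f \<in> L}"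
    proof (rule ideal_span_minimal)
      show "S i \<subseteq> {a. shift scale a i f \<in> L}"
        using that P.operator_submoduleD(2)[OF L(2)] unfolding shifts_def by blast
      have *: "shift scale (a + b) i f = shift scale a i f + shift scale b i f"
        "shift scale 0 i f = 0" "shift scale (c * a) i f = pointwise scale c (shift scale a i f)" for a b c
        by (auto simp: shift_def pointwise_def fun_eq_iff scale_left_distrib)
      show "ideal {a. shift scale a i f \<in> L}"
        unfolding ideal_iff
        using P.subspace_0[OF sL] P.subspace_add[OF sL] P.subspace_scale[OF sL] by (simp add: *)
    qed
    with that S show ?thesis by blast
  qed
  have op: "operator_submodule (pointwise scale) (shifts scale I t) L"
    using sL shift_L unfolding operator_submodule_def shifts_def by auto
  have "shifts scale S t \<subseteq> shifts scale I t"
    unfolding shifts_def using S(2) ideal_span_superset by fastforce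
  then have noeth: "operator_noetherian (pointwise scale) (shifts scale I t) L"
    using P.operator_noetherian_mono[OF L(3)] by blast
  have ideal_L: "ideal {a. homogeneous n (a *s u) \<in> L}" for n u
    using ideal_scale_vimage[OF subspace_homogeneous_vimage[OF sL]] by simp
  have pow: "homogeneous (n(i := n i + k)) (a *s u) \<in> L"
    if "i < t" "homogeneous n u \<in> L" "a \<in> ideal_pow (I i) k" for n i k a u
    using that(3)
  proof (induction k arbitrary: a)
    case 0
    show ?case using P.subspace_scale[OF sL that(2)] by (simp add: homogeneous_scale)
  next
    case (Suc k)
    have "ideal_pow (I i) (Suc k) \<subseteq> {a. homogeneous (n(i := n i + Suc k)) (a *s u) \<in> L}"
      unfolding ideal_pow.simps
    proof (rule ideal_prod_minimal[OF ideal_L])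
      fix a b assume "a \<in> I i" "b \<in> ideal_pow (I i) k"
      then have "shift scale a i (homogeneous (n(i := n i + k)) (b *s u)) \<in> L"
        by (intro shift_L Suc.IH that)
      then show "a * b \<in> {a. homogeneous (n(i := n i + Suc k)) (a *s u) \<in> L}"
        by (simp add: shift_homogeneous)
    qed
    with Suc.prems show ?case by blast
  qed
  \<comment> \<open>The multi-index is truncated at \<open>s\<close> because the product of powers
    is built one factor at a time, starting from degree zero.\<close>
  have multipow: "homogeneous (\<lambda>i. if i < s then n i else 0) (a *s u) \<in> L"
    if "s \<le> t" "a \<in> ideal_multipow I n s" for n s a u
    using that
  proof (induction s arbitrary: a)
    case 0
    show ?case using L(1) by (auto simp: L0_def)
  next
    case (Suc s)
    have "ideal_multipow I n (Suc s) \<subseteq> {a. homogeneous (\<lambda>i. if i < Suc s then n i else 0) (a *s u) \<in> L}"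
      unfolding ideal_multipow.simps
    proof (rule ideal_prod_minimal[OF ideal_L])
      fix a b assume a: "a \<in> ideal_multipow I n s" and b: "b \<in> ideal_pow (I s) (n s)"
      let ?m = "\<lambda>i. if i < s then n i else 0"
      have "homogeneous (?m(s := ?m s + n s)) (b *s a *s u) \<in> L"
        using Suc.prems(1) b by (intro pow Suc.IH a) auto
      moreover have "?m(s := ?m s + n s) = (\<lambda>i. if i < Suc s then n i else 0)"
        by (auto simp: fun_eq_iff less_Suc_eq)
      ultimately show "a * b \<in> {a. homogeneous (\<lambda>i. if i < Suc s then n i else 0) (a *s u) \<in> L}"
        by (simp add: mult.commute)
    qed
    with Suc.prems(2) show ?case by blast
  qed
  have "homogeneous n u \<in> L"
    if "\<forall>i\<ge>t. n i = 0" "u \<in> ideal_smult scale (ideal_multipow I n t) UNIV" for n u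
  proof -
    have n: "(\<lambda>i. if i < t then n i else 0) = n" using that(1) by (auto simp: fun_eq_iff)
    have "ideal_smult scale (ideal_multipow I n t) UNIV \<subseteq> {u. homogeneous n u \<in> L}"
      by (rule ideal_smult_minimal[OF subspace_homogeneous_vimage[OF sL]])
        (use multipow[of t _ n, unfolded n] in simp)
    with that(2) show ?thesis by blast
  qed
  with op noeth show ?thesis by (intro exI[of _ L] conjI allI impI)
qed

end

section \<open>Uniform Artin-Rees and saturation bounds\<close>

context module
begin

lemma ideal_smult_multipow_Suc:
  assumes "i < t" "a \<in> I i" "u \<in> ideal_smult scale (ideal_multipow I n t) UNIV"
  shows "a *s u \<in> ideal_smult scale (ideal_multipow I (n(i := Suc (n i))) t) UNIV"
proof -
  have "ideal_smult scale (ideal_multipow I n t) UNIV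
      \<subseteq> {u. a *s u \<in> ideal_smult scale (ideal_multipow I (n(i := Suc (n i))) t) UNIV}"
  proof (rule ideal_smult_minimal[OF subspace_scale_vimage[OF subspace_ideal_smult]])
    fix b x assume "b \<in> ideal_multipow I n t"
    from ideal_multipow_Suc_mem[OF assms(1,2) this]
    show "b *s x \<in> {u. a *s u \<in> ideal_smult scale (ideal_multipow I (n(i := Suc (n i))) t) UNIV}"
      by (simp add: ideal_smult_mem)
  qed
  with assms(3) show ?thesis by blast
qed

text \<open>Two increments of a multi-index commute, so the family of all \<open>M_(n+e)\<close>,
  with \<open>e\<close> a fixed unit vector, is again compatible with the action of the
  ideals.\<close>

lemma ideal_smult_multipow_Suc_Suc:
  assumes "j < t" "a \<in> I j" "u \<in> ideal_smult scale (ideal_multipow I (n(i := Suc (n i))) t) UNIV"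
  shows "a *s u \<in> ideal_smult scale
    (ideal_multipow I ((n(j := Suc (n j)))(i := Suc ((n(j := Suc (n j))) i))) t) UNIV"
proof -
  have "(n(i := Suc (n i)))(j := Suc ((n(i := Suc (n i))) j))
      = (n(j := Suc (n j)))(i := Suc ((n(j := Suc (n j))) i))"
    by auto
  with ideal_smult_multipow_Suc[OF assms] show ?thesis by simp
qed

text \<open>Component \<open>n\<close> of a shifted function is zero if \<open>n i = 0\<close>;
  otherwise it comes from the component one step lower in direction \<open>i\<close>, where
  \<open>step\<close> applies.\<close>

lemma operator_submodule_gradedI:
  assumes L: "operator_submodule (pointwise scale) (shifts scale I t) L"
    and X: "\<And>n. subspace (X n)"
    and step: "\<And>n i a u. i < t \<Longrightarrow> a \<in> I i \<Longrightarrow> u \<in> X n \<Longrightarrow> a *s u \<in> X (n(i := Suc (n i)))"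
  shows "operator_submodule (pointwise scale) (shifts scale I t) (L \<inter> {f. \<forall>n. f n \<in> X n})"
proof -
  interpret P: module "pointwise scale" by (rule module_pointwise)
  have "operator_submodule (pointwise scale) (shifts scale I t) {f. \<forall>n. f n \<in> X n}"
    unfolding operator_submodule_def
  proof (intro conjI ballI)
    show "P.subspace {f. \<forall>n. f n \<in> X n}"
      using subspace_0[OF X] subspace_add[OF X] subspace_scale[OF X]
      by (intro P.subspaceI) (auto simp: pointwise_def)
  next
    fix \<phi> f assume "\<phi> \<in> shifts scale I t" and f: "f \<in> {f. \<forall>n. f n \<in> X n}"
    then obtain i a where \<phi>: "\<phi> = shift scale a i" "i < t" "a \<in> I i" by (auto simp: shifts_def)
    have "shift scale a i f n \<in> X n" for n
    proof (cases "n i = 0")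
      case True
      then show ?thesis using subspace_0[OF X] by (simp add: shift_def)
    next
      case False
      let ?n = "n(i := n i - 1)"
      have "a *s f ?n \<in> X (?n(i := Suc (?n i)))" using f by (intro step \<phi>) auto
      moreover have "?n(i := Suc (?n i)) = n" using False by auto
      ultimately show ?thesis using False by (simp add: shift_def)
    qed
    then show "\<phi> f \<in> {f. \<forall>n. f n \<in> X n}" by (simp add: \<phi>(1))
  qed
  with L show ?thesis by (rule P.operator_submodule_Int)
qed

text \<open>The chain to which the ascending chain condition is applied lives in the Rees module of the
  ideals \<open>I\<^sub>0, \<dots>, I\<^sub>t\<^sub>-\<^sub>1, J\<close>; its \<open>c\<close>-th member has components \<open>J\<^bsup>m-c\<^esup> X\<^sub>n\<close>.\<close>

lemma multigraded_Artin_Rees: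
  assumes R: "noetherian_ring TYPE('a)" and fg: "fin_gen_module scale"
    and I: "\<And>i. i < t \<Longrightarrow> ideal (I i)" and J: "ideal J"
    and X: "\<And>n. subspace (X n)"
    and step: "\<And>n i a u. i < t \<Longrightarrow> a \<in> I i \<Longrightarrow> u \<in> X n \<Longrightarrow> a *s u \<in> X (n(i := Suc (n i)))"
  shows "\<exists>c. \<forall>n m u. (\<forall>i\<ge>t. n i = 0) \<longrightarrow> u \<in> X n \<longrightarrow>
    u \<in> ideal_smult scale (ideal_pow J m) (ideal_smult scale (ideal_multipow I n t) UNIV) \<longrightarrow>
    u \<in> ideal_smult scale (ideal_pow J (m - c)) (X n)"
proof -
  interpret P: module "pointwise scale" by (rule module_pointwise)
  \<comment> \<open>\<open>J\<close> becomes one more ideal of the family, and coordinate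
    \<open>t\<close> of a multi-index holds its exponent.\<close>
  let ?I = "I(t := J)"
  have "\<And>i. i < Suc t \<Longrightarrow> ideal (?I i)" using I J by (auto simp: less_Suc_eq)
  from Rees_module_noetherian[where I = ?I and t = "Suc t", OF R fg this] obtain L where
    L: "operator_submodule (pointwise scale) (shifts scale ?I (Suc t)) L"
      "operator_noetherian (pointwise scale) (shifts scale ?I (Suc t)) L"
    and mem: "\<And>n u. \<forall>i\<ge>Suc t. n i = 0 \<Longrightarrow>
      u \<in> ideal_smult scale (ideal_multipow ?I n (Suc t)) UNIV \<Longrightarrow> homogeneous n u \<in> L"
    by metis
  \<comment> \<open>Truncated subtraction matters: for \<open>n t \<le> c\<close> the power of
    \<open>J\<close> is the whole ring and only membership in \<open>X\<close> is demanded.\<close>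
  define Y where "Y c n = ideal_smult scale (ideal_pow J (n t - c)) (X (n(t := 0)))" for c n
  define U where "U c = L \<inter> {f. \<forall>n. f n \<in> Y c n}" for c
  have Y_mono: "Y c n \<subseteq> Y d n" if "c \<le> d" for c d n
    unfolding Y_def using that by (intro ideal_smult_mono ideal_pow_antimono) auto
  have U: "operator_submodule (pointwise scale) (shifts scale ?I (Suc t)) (U c)" for c
    unfolding U_def
  proof (rule operator_submodule_gradedI[OF L(1)])
    show "subspace (Y c n)" for n unfolding Y_def by (rule subspace_ideal_smult)
    fix n i a u assume i: "i < Suc t" and a: "a \<in> ?I i" and u: "u \<in> Y c n"
    show "a *s u \<in> Y c (n(i := Suc (n i)))"
    proof (cases "i = t")
      case True
      have "a *s u \<in> ideal_smult scale (ideal_pow J (Suc (n t - c))) (X (n(t := 0)))"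
        using a u True by (intro ideal_smult_pow_Suc) (auto simp: Y_def)
      \<comment> \<open>With truncated subtraction \<open>Suc (n t) - c\<close> may be smaller than
        \<open>Suc (n t - c)\<close>, so this is only an inclusion.\<close>
      moreover have "\<dots> \<subseteq> ideal_smult scale (ideal_pow J (Suc (n t) - c)) (X (n(t := 0)))"
        by (intro ideal_smult_mono ideal_pow_antimono) auto
      ultimately show ?thesis using True by (auto simp: Y_def)
    next
      case False
      have "a *s x \<in> X ((n(t := 0))(i := Suc (n i)))" if "x \<in> X (n(t := 0))" for x
        using step[of i a x "n(t := 0)"] that i a False by auto
      then have "a *s u \<in> ideal_smult scale (ideal_pow J (n t - c)) (X ((n(t := 0))(i := Suc (n i))))"
        using u unfolding Y_def by (rule ideal_smult_scale)
      moreover have "(n(t := 0))(i := Suc (n i)) = (n(i := Suc (n i)))(t := 0)"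
        using False by (rule fun_upd_twist[OF not_sym])
      ultimately show ?thesis using False by (simp add: Y_def)
    qed
  qed
  have "incseq U" unfolding incseq_def U_def using Y_mono by blast
  obtain c where c: "\<And>d. d \<ge> c \<Longrightarrow> U d = U c"
    using P.operator_noetherianD[where U = U, OF L(2) U _ \<open>incseq U\<close>] U_def by (metis Int_lower1)
  have "u \<in> ideal_smult scale (ideal_pow J (m - c)) (X n)"
    if n: "\<forall>i\<ge>t. n i = 0" and uX: "u \<in> X n"
      and u: "u \<in> ideal_smult scale (ideal_pow J m) (ideal_smult scale (ideal_multipow I n t) UNIV)"
    for n m u
  proof -
    let ?n = "n(t := m)"
    have n0: "?n(t := 0) = n" using n by auto
    have "ideal_multipow ?I ?n t = ideal_multipow I n t" by (rule ideal_multipow_cong) auto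
    then have "ideal_multipow ?I ?n (Suc t) = ideal_prod (ideal_multipow I n t) (ideal_pow J m)"
      by simp
    then have "u \<in> ideal_smult scale (ideal_multipow ?I ?n (Suc t)) UNIV"
      using u ideal_smult_ideal_smult_subset[of "ideal_pow J m" "ideal_multipow I n t" UNIV] by auto
    then have uL: "homogeneous ?n u \<in> L" using n by (intro mem) auto
    \<comment> \<open>At position \<open>max c m\<close> the exponent of \<open>J\<close> is zero,
      so \<open>u \<in> X n\<close> suffices for membership in the chain. Stabilisation then carries
      the monomial down to position \<open>c\<close>.\<close>
    have "u = 1 *s u" by simp
    also have "\<dots> \<in> ideal_smult scale (ideal_pow J (?n t - max c m)) (X (?n(t := 0)))"
      unfolding n0 by (rule ideal_smult_mem) (use uX in auto)
    finally have "u \<in> Y (max c m) ?n" by (simp add: Y_def)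
    moreover have "0 \<in> Y d k" for d k unfolding Y_def by (rule subspace_0[OF subspace_ideal_smult])
    ultimately have "homogeneous ?n u \<in> U (max c m)"
      using uL by (simp add: U_def homogeneous_def)
    also have "U (max c m) = U c" by (rule c) simp
    finally have "homogeneous ?n u ?n \<in> Y c ?n" unfolding U_def by blast
    then show ?thesis unfolding Y_def n0 by (simp add: homogeneous_def)
  qed
  then show ?thesis by (intro exI[of _ c] allI impI)
qed

text \<open>The saturation bound is applied once, to the part \<open>N\<close> of the Rees module
  with components \<open>M_(n+e)\<close>. Its instances at monomials of degree \<open>n\<close> give
  the claim for all \<open>n\<close> with the same ideals and exponent.\<close>

lemma multigraded_saturation:
  fixes I :: "nat \<Rightarrow> 'a set" and t :: nat
  defines "M \<equiv> \<lambda>n. ideal_smult scale (ideal_multipow I n t) UNIV"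
  assumes R: "noetherian_ring TYPE('a)" and fg: "fin_gen_module scale"
    and I: "\<And>i. i < t \<Longrightarrow> ideal (I i)"
  shows "\<exists>F r. finite F \<and> (\<forall>J'\<in>F. ideal J') \<and> (\<forall>J. ideal J \<longrightarrow> (\<exists>J'\<in>F. J \<subseteq> J' \<and>
    (\<forall>n u m. (\<forall>i\<ge>t. n i = 0) \<longrightarrow> u \<in> M n \<longrightarrow>
      u \<in> colon scale (M (n(i := Suc (n i)))) (ideal_pow J m) \<longrightarrow>
      u \<in> colon scale (M (n(i := Suc (n i)))) (ideal_pow J' r))))"
proof -
  interpret P: module "pointwise scale" by (rule module_pointwise)
  let ?M = "\<lambda>n. M (n(i := Suc (n i)))"
  from Rees_module_noetherian[where I = I and t = t, OF R fg I] obtain L where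
    L: "operator_submodule (pointwise scale) (shifts scale I t) L"
      "operator_noetherian (pointwise scale) (shifts scale I t) L"
    and mem: "\<And>n u. \<forall>i\<ge>t. n i = 0 \<Longrightarrow> u \<in> M n \<Longrightarrow> homogeneous n u \<in> L"
    unfolding M_def by metis
  have sM: "subspace (M n)" for n unfolding M_def by (rule subspace_ideal_smult)
  define N where "N = L \<inter> {f. \<forall>n. f n \<in> ?M n}"
  have N: "operator_submodule (pointwise scale) (shifts scale I t) N"
    unfolding N_def
  proof (rule operator_submodule_gradedI[OF L(1) sM])
    fix n j a u assume "j < t" "a \<in> I j" "u \<in> ?M n"
    then show "a *s u \<in> ?M (n(j := Suc (n j)))"
      unfolding M_def by (rule ideal_smult_multipow_Suc_Suc)
  qed
  have hom: "module_hom (pointwise scale) (pointwise scale) \<phi>" if "\<phi> \<in> shifts scale I t" for \<phi>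
    using that by (auto simp: shifts_def module_hom_shift)
  have "N \<subseteq> L" by (simp add: N_def)
  from P.finite_ideals_for_saturation[OF R L hom N this] obtain F r
    where F: "finite F" "\<forall>J'\<in>F. ideal J'"
      and Fr: "\<And>J. ideal J \<Longrightarrow> \<exists>J'\<in>F. J \<subseteq> J' \<and> (\<forall>f\<in>L. \<forall>m.
        f \<in> colon (pointwise scale) N (ideal_pow J m) \<longrightarrow> f \<in> colon (pointwise scale) N (ideal_pow J' r))"
    by metis
  have colon_N: "homogeneous n u \<in> colon (pointwise scale) N K \<longleftrightarrow> u \<in> colon scale (?M n) K"
    if "\<forall>i\<ge>t. n i = 0" "u \<in> M n" for n u K
  proof -
    have "homogeneous n (a *s u) \<in> N \<longleftrightarrow> a *s u \<in> ?M n" for a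
    proof -
      have "homogeneous n (a *s u) \<in> L" using that subspace_scale[OF sM] by (intro mem) auto
      then show ?thesis using subspace_0[OF sM] by (auto simp: N_def homogeneous_def)
    qed
    then show ?thesis by (simp add: colon_def homogeneous_scale)
  qed
  show ?thesis
  proof (rule exI[of _ F], rule exI[of _ r], intro conjI F allI impI)
    fix J :: "'a set" assume "ideal J"
    from Fr[OF this] obtain J' where J': "J' \<in> F" "J \<subseteq> J'"
      and *: "\<And>f m. f \<in> L \<Longrightarrow> f \<in> colon (pointwise scale) N (ideal_pow J m) \<Longrightarrow>
        f \<in> colon (pointwise scale) N (ideal_pow J' r)" by metis
    have "u \<in> colon scale (?M n) (ideal_pow J' r)"
      if "\<forall>i\<ge>t. n i = 0" "u \<in> M n" "u \<in> colon scale (?M n) (ideal_pow J m)" for n u m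
      using *[OF mem[OF that(1,2)]] that(3) colon_N[OF that(1,2)] by simp
    with J' show "\<exists>J'\<in>F. J \<subseteq> J' \<and> (\<forall>n u m. (\<forall>i\<ge>t. n i = 0) \<longrightarrow> u \<in> M n \<longrightarrow>
      u \<in> colon scale (?M n) (ideal_pow J m) \<longrightarrow> u \<in> colon scale (?M n) (ideal_pow J' r))"
      by (intro bexI[of _ J'] conjI allI impI)
  qed
qed

text \<open>One \<open>J'\<close> has to serve all directions \<open>i\<close>. Ideals for different
  directions are intersected and the larger exponent is kept, since shrinking \<open>J'\<close> or
  raising the exponent preserves the bound.\<close>

lemma multigraded_saturation_simultaneous:
  fixes I :: "nat \<Rightarrow> 'a set" and t s :: nat
  defines "M \<equiv> \<lambda>n. ideal_smult scale (ideal_multipow I n t) UNIV"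
  assumes R: "noetherian_ring TYPE('a)" and fg: "fin_gen_module scale"
    and I: "\<And>i. i < t \<Longrightarrow> ideal (I i)"
  shows "\<exists>F r. finite F \<and> (\<forall>J'\<in>F. ideal J') \<and> (\<forall>J. ideal J \<longrightarrow> (\<exists>J'\<in>F. J \<subseteq> J' \<and>
    (\<forall>i<s. \<forall>n u m. (\<forall>i\<ge>t. n i = 0) \<longrightarrow> u \<in> M n \<longrightarrow>
      u \<in> colon scale (M (n(i := Suc (n i)))) (ideal_pow J m) \<longrightarrow>
      u \<in> colon scale (M (n(i := Suc (n i)))) (ideal_pow J' r))))"
proof (induction s)
  case 0
  show ?case by (intro exI[of _ "{UNIV}"] exI[of _ 0]) simp
next
  case (Suc s)
  define Q where "Q J J' r i \<longleftrightarrow> (\<forall>n u m. (\<forall>i\<ge>t. n i = 0) \<longrightarrow> u \<in> M n \<longrightarrow>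
      u \<in> colon scale (M (n(i := Suc (n i)))) (ideal_pow J m) \<longrightarrow>
      u \<in> colon scale (M (n(i := Suc (n i)))) (ideal_pow J' r))" for J J' r i
  from Suc obtain F r where F: "finite F" "\<And>J'. J' \<in> F \<Longrightarrow> ideal J'"
    "\<And>J. ideal J \<Longrightarrow> \<exists>J'\<in>F. J \<subseteq> J' \<and> (\<forall>i<s. Q J J' r i)"
    unfolding Q_def by metis
  from multigraded_saturation[where I = I and t = t and i = s, OF R fg I] obtain G q
    where G: "finite G" "\<And>J'. J' \<in> G \<Longrightarrow> ideal J'"
    "\<And>J. ideal J \<Longrightarrow> \<exists>J'\<in>G. J \<subseteq> J' \<and> Q J J' q s"
    unfolding Q_def M_def by metis
  have Q_mono: "Q J K' r' i" if "Q J J' r i" "K' \<subseteq> J'" "r \<le> r'" for J J' K' r r' i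
  proof -
    have "ideal_pow K' r' \<subseteq> ideal_pow J' r"
      using ideal_pow_mono[OF that(2)] ideal_pow_antimono[OF that(3)] by blast
    from colon_antimono[OF this] that(1) show ?thesis unfolding Q_def by blast
  qed
  have "\<exists>J'\<in>(\<lambda>(A, B). A \<inter> B) ` (F \<times> G). J \<subseteq> J' \<and> (\<forall>i<Suc s. Q J J' (max r q) i)"
    if "ideal J" for J
  proof -
    from F(3)[OF that] obtain A where A: "A \<in> F" "J \<subseteq> A" "\<And>i. i < s \<Longrightarrow> Q J A r i" by metis
    from G(3)[OF that] obtain B where B: "B \<in> G" "J \<subseteq> B" "Q J B q s" by metis
    have "Q J (A \<inter> B) (max r q) i" if "i < Suc s" for i
    proof (cases "i = s")
      case True
      then show ?thesis using Q_mono[OF B(3)] by simp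
    next
      case False
      with that have "i < s" by simp
      then show ?thesis using Q_mono[OF A(3)] by simp
    qed
    moreover have "A \<inter> B \<in> (\<lambda>(A, B). A \<inter> B) ` (F \<times> G)" using A B by auto
    ultimately show ?thesis using A(2) B(2) by (intro bexI[of _ "A \<inter> B"]) auto
  qed
  moreover have "finite ((\<lambda>(A, B). A \<inter> B) ` (F \<times> G))" using F(1) G(1) by simp
  moreover have "\<forall>J'\<in>(\<lambda>(A, B). A \<inter> B) ` (F \<times> G). ideal J'"
    using F(2) G(2) by (auto intro: ideal_Int)
  ultimately show ?case unfolding Q_def
    by (intro exI[of _ "(\<lambda>(A, B). A \<inter> B) ` (F \<times> G)"] exI[of _ "max r q"] conjI allI impI)
qed

text \<open>Artin-Rees is used twice. For the colon submodules, with constant \<open>d\<close>, it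
  leaves at least \<open>r\<close> powers of \<open>J\<close>, enough to put \<open>u\<close> into
  \<open>M_(n+e)\<close>. For the family \<open>M_(n+e)\<close> itself, with constant
  \<open>c\<close>, it then retains the powers of \<open>J\<close>. So \<open>k = c + d + r\<close>
  works.\<close>

lemma multigraded_descent:
  fixes I :: "nat \<Rightarrow> 'a set" and t r :: nat
  defines "M \<equiv> \<lambda>n. ideal_smult scale (ideal_multipow I n t) UNIV"
  assumes R: "noetherian_ring TYPE('a)" and fg: "fin_gen_module scale"
    and I: "\<And>i. i < t \<Longrightarrow> ideal (I i)" and J: "ideal J"
  shows "\<exists>k. \<forall>n m u. (\<forall>i\<ge>t. n i = 0) \<longrightarrow> k \<le> m \<longrightarrow> u \<in> ideal_smult scale (ideal_pow J m) (M n) \<longrightarrow>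
    u \<in> colon scale (M (n(i := Suc (n i)))) (ideal_pow J r) \<longrightarrow>
    u \<in> ideal_smult scale (ideal_pow J (m - k)) (M (n(i := Suc (n i))))"
proof -
  let ?M = "\<lambda>n. M (n(i := Suc (n i)))" and ?N = "\<lambda>n. colon scale (M (n(i := Suc (n i)))) (ideal_pow J r)"
  have sM: "subspace (M n)" for n unfolding M_def by (rule subspace_ideal_smult)
  have M_step: "a *s u \<in> ?M (n(j := Suc (n j)))" if "j < t" "a \<in> I j" "u \<in> ?M n" for n j a u
    using that unfolding M_def by (rule ideal_smult_multipow_Suc_Suc)
  have N_step: "a *s u \<in> ?N (n(j := Suc (n j)))" if "j < t" "a \<in> I j" "u \<in> ?N n" for n j a u
    unfolding colon_def
  proof (intro CollectI ballI)
    fix b assume "b \<in> ideal_pow J r"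
    then have "b *s u \<in> ?M n" using that(3) unfolding colon_def by blast
    from M_step[OF that(1,2) this] show "b *s a *s u \<in> ?M (n(j := Suc (n j)))"
      by (subst scale_left_commute)
  qed
  obtain c where c: "\<And>n m u. \<forall>i\<ge>t. n i = 0 \<Longrightarrow> u \<in> ?M n \<Longrightarrow>
      u \<in> ideal_smult scale (ideal_pow J m) (M n) \<Longrightarrow> u \<in> ideal_smult scale (ideal_pow J (m - c)) (?M n)"
    using multigraded_Artin_Rees[where X = ?M and I = I and t = t, OF R fg I J sM M_step] unfolding M_def by metis
  obtain d where d: "\<And>n m u. \<forall>i\<ge>t. n i = 0 \<Longrightarrow> u \<in> ?N n \<Longrightarrow>
      u \<in> ideal_smult scale (ideal_pow J m) (M n) \<Longrightarrow> u \<in> ideal_smult scale (ideal_pow J (m - d)) (?N n)"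
    using multigraded_Artin_Rees[where X = ?N and I = I and t = t, OF R fg I J subspace_colon[OF sM] N_step] unfolding M_def by metis
  have "u \<in> ideal_smult scale (ideal_pow J (m - (c + d + r))) (?M n)"
    if n: "\<forall>i\<ge>t. n i = 0" and m: "c + d + r \<le> m" and u: "u \<in> ideal_smult scale (ideal_pow J m) (M n)"
      and uN: "u \<in> ?N n" for n m u
  proof -
    have "r \<le> m - d" using m by simp
    have "ideal_smult scale (ideal_pow J (m - d)) (?N n) \<subseteq> ?M n"
    proof (rule ideal_smult_minimal[OF sM])
      fix a x assume "a \<in> ideal_pow J (m - d)" and x: "x \<in> ?N n"
      then have "a \<in> ideal_pow J r" using ideal_pow_antimono[OF \<open>r \<le> m - d\<close>] by blast
      with x show "a *s x \<in> ?M n" unfolding colon_def by blast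
    qed
    with d[OF n uN u] have "u \<in> ?M n" by blast
    from c[OF n this u] show ?thesis
      by (rule subsetD[OF ideal_smult_mono[OF ideal_pow_antimono order_refl], rotated]) simp
  qed
  then show ?thesis by (intro exI[of _ "c + d + r"] allI impI)
qed

end

section \<open>The climb from \<open>M\<close> to \<open>M_n\<close>\<close>

theorem theorem3p3:
  fixes scale :: "'a::comm_ring_1 \<Rightarrow> 'm::ab_group_add \<Rightarrow> 'm"
    and I :: "nat \<Rightarrow> 'a set" and t :: nat
  assumes "noetherian_ring TYPE('a)"
    and "module scale"
    and "fin_gen_module scale"
    and "\<forall>i<t. ideal (I i)"
  shows "\<exists>k::nat. \<forall>(n :: nat \<Rightarrow> nat) (J :: 'a set). ideal J \<longrightarrow>
           ideal_smult scale (ideal_pow J (k * (\<Sum>i<t. n i))) UNIV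
             \<inter> colon_inf scale (ideal_smult scale (ideal_multipow I n t) UNIV) J
           \<subseteq> ideal_smult scale (ideal_multipow I n t) UNIV"
proof -
  interpret module scale by fact
  note R = assms(1) and fg = assms(3)
  have I: "\<And>i. i < t \<Longrightarrow> ideal (I i)" using assms(4) by simp
  define M where "M n = ideal_smult scale (ideal_multipow I n t) UNIV" for n
  let ?up = "\<lambda>n i. n(i := Suc (n i))"
  have sM: "subspace (M n)" for n unfolding M_def by (rule subspace_ideal_smult)
  obtain F r where F: "finite F" "\<And>J'. J' \<in> F \<Longrightarrow> ideal J'"
    and sat: "\<And>J. ideal J \<Longrightarrow> \<exists>J'\<in>F. J \<subseteq> J' \<and>
      (\<forall>i<t. \<forall>n u m. (\<forall>i\<ge>t. n i = 0) \<longrightarrow> u \<in> M n \<longrightarrow>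
        u \<in> colon scale (M (?up n i)) (ideal_pow J m) \<longrightarrow> u \<in> colon scale (M (?up n i)) (ideal_pow J' r))"
    using multigraded_saturation_simultaneous[where I = I and t = t and s = t, OF R fg I] unfolding M_def by metis
  define D where "D k J i \<longleftrightarrow> (\<forall>n m u. (\<forall>i\<ge>t. n i = 0) \<longrightarrow> k \<le> m \<longrightarrow>
      u \<in> ideal_smult scale (ideal_pow J m) (M n) \<longrightarrow> u \<in> colon scale (M (?up n i)) (ideal_pow J r) \<longrightarrow>
      u \<in> ideal_smult scale (ideal_pow J (m - k)) (M (?up n i)))" for k J i
  have "\<forall>Ji\<in>F \<times> {..<t}. \<exists>k. D k (fst Ji) (snd Ji)"
    unfolding D_def M_def using multigraded_descent[where I = I and t = t, OF R fg I F(2)] by simp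
  from bchoice[OF this] obtain \<kappa> where \<kappa>: "\<And>J i. J \<in> F \<Longrightarrow> i < t \<Longrightarrow> D (\<kappa> (J, i)) J i"
    by auto
  \<comment> \<open>The sum bounds every \<open>\<kappa> (J, i)\<close>. Finiteness of
    \<open>F\<close> makes this possible, and it is why \<open>k\<close> depends neither on
    \<open>n\<close> nor on the ideal given later.\<close>
  define k where "k = sum \<kappa> (F \<times> {..<t})"
  have D: "D k J i" if "J \<in> F" "i < t" for J i
  proof -
    have "\<kappa> (J, i) \<le> k" unfolding k_def using that F(1) by (intro member_le_sum) auto
    then have "ideal_smult scale (ideal_pow J (m - \<kappa> (J, i))) N \<subseteq> ideal_smult scale (ideal_pow J (m - k)) N"
      for m N by (intro ideal_smult_mono ideal_pow_antimono) auto
    with \<kappa>[OF that] \<open>\<kappa> (J, i) \<le> k\<close> show ?thesis unfolding D_def by (meson order_trans subsetD)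
  qed
  have main: "u \<in> M n"
    if J: "ideal J" and n: "\<forall>i\<ge>t. n i = 0"
      and u: "u \<in> ideal_smult scale (ideal_pow J (k * (\<Sum>i<t. n i))) UNIV"
      and um: "u \<in> colon scale (M n) (ideal_pow J m)" for n :: "nat \<Rightarrow> nat" and J u m
  proof -
    from sat[OF J] obtain J' where J': "J' \<in> F" "J \<subseteq> J'" and
      sat': "\<And>i n u m. i < t \<Longrightarrow> \<forall>i\<ge>t. n i = 0 \<Longrightarrow> u \<in> M n \<Longrightarrow>
        u \<in> colon scale (M (?up n i)) (ideal_pow J m) \<Longrightarrow> u \<in> colon scale (M (?up n i)) (ideal_pow J' r)"
      by metis
    \<comment> \<open>Invariant of the climb: at \<open>p\<close>, \<open>q\<close> unit steps
      towards \<open>n\<close> remain, and \<open>k * q\<close> powers of \<open>J'\<close> are left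
      to pay for them.\<close>
    have descend: "u \<in> M n"
      if "(\<Sum>i<t. p i) + q = (\<Sum>i<t. n i)" "\<forall>i. p i \<le> n i" "u \<in> ideal_smult scale (ideal_pow J' (k * q)) (M p)"
      for q p
      using that
    proof (induction q arbitrary: p)
      case 0
      \<comment> \<open>No steps remain: \<open>p \<le> n\<close> with equal sums forces equality
        below \<open>t\<close>.\<close>
      have "p i = n i" if "i < t" for i
      proof (rule ccontr)
        assume "p i \<noteq> n i"
        with 0(2) have "p i < n i" by (simp add: le_neq_implies_less)
        then have "(\<Sum>i<t. p i) < (\<Sum>i<t. n i)" using 0(2) that by (intro sum_strict_mono_ex1) auto
        with 0(1) show False by simp
      qed
      then have "M p = M n" unfolding M_def using ideal_multipow_cong[of t I I p n] by simp
      moreover have "ideal_smult scale (ideal_pow J' (k * 0)) (M p) \<subseteq> M p"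
        by (rule ideal_smult_minimal[OF sM]) (rule subspace_scale[OF sM])
      ultimately show ?case using 0(3) by blast
    next
      case (Suc q)
      have p: "\<forall>i\<ge>t. p i = 0" using n Suc.prems(2) by (metis le_zero_eq)
      have "\<exists>i<t. p i < n i"
      proof (rule ccontr)
        assume "\<not> ?thesis"
        then have "(\<Sum>i<t. n i) \<le> (\<Sum>i<t. p i)" by (intro sum_mono) auto
        with Suc.prems(1) show False by simp
      qed
      then obtain i where i: "i < t" "p i < n i" by blast
      let ?p = "?up p i"
      have p_le: "\<forall>i. ?p i \<le> n i" using i Suc.prems(2) by simp
      have "(\<Sum>j<t. ?p j) = Suc (\<Sum>j<t. p j)"
        using i(1) by (simp add: sum.remove[of "{..<t}" i])
      then have sum_p: "(\<Sum>j<t. ?p j) + q = (\<Sum>j<t. n j)" using Suc.prems(1) by simp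
      have "ideal_smult scale (ideal_pow J' (k * Suc q)) (M p) \<subseteq> M p"
        by (rule ideal_smult_minimal[OF sM]) (rule subspace_scale[OF sM])
      with Suc.prems(3) have "u \<in> M p" by blast
      \<comment> \<open>The assumption on \<open>J\<close> concerns \<open>M n\<close> but passes to
        the larger \<open>M ?p\<close>, since \<open>?p \<le> n\<close>. Saturation then replaces
        \<open>J^m\<close> by \<open>J'^r\<close>.\<close>
      moreover have "M n \<subseteq> M ?p"
        unfolding M_def using p_le by (intro ideal_smult_mono ideal_multipow_antimono order_refl) blast
      then have "u \<in> colon scale (M ?p) (ideal_pow J m)" using um colon_mono by blast
      ultimately have "u \<in> colon scale (M ?p) (ideal_pow J' r)" by (rule sat'[OF i(1) p])
      moreover have "k \<le> k * Suc q" by simp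
      ultimately have "u \<in> ideal_smult scale (ideal_pow J' (k * Suc q - k)) (M ?p)"
        using D[OF J'(1) i(1)] p Suc.prems(3) unfolding D_def by blast
      then have "u \<in> ideal_smult scale (ideal_pow J' (k * q)) (M ?p)" by simp
      from Suc.IH[OF sum_p p_le this] show ?case .
    qed
    \<comment> \<open>The climb starts at multi-index zero, where \<open>M_0 = M\<close>, and
      \<open>J \<subseteq> J'\<close> turns the given powers of \<open>J\<close> into powers of
      \<open>J'\<close>.\<close>
    have "u \<in> ideal_smult scale (ideal_pow J' (k * (\<Sum>i<t. n i))) (M (\<lambda>_. 0))"
    proof -
      have "x \<in> M (\<lambda>_. 0)" for x
        using ideal_smult_mem[of 1 UNIV x UNIV] by (simp add: M_def ideal_multipow_zero)
      then have "M (\<lambda>_. 0) = UNIV" by blast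
      with u show ?thesis using ideal_smult_mono[OF ideal_pow_mono[OF J'(2)] order_refl] by auto
    qed
    then show ?thesis by (intro descend) simp_all
  qed
  show ?thesis
  proof (intro exI allI impI subsetI, elim IntE)
    fix n :: "nat \<Rightarrow> nat" and J :: "'a set" and u
    assume J: "ideal J" and u: "u \<in> ideal_smult scale (ideal_pow J (k * (\<Sum>i<t. n i))) UNIV"
      and "u \<in> colon_inf scale (ideal_smult scale (ideal_multipow I n t) UNIV) J"
    then obtain m where m: "u \<in> colon scale (M n) (ideal_pow J m)" by (auto simp: colon_inf_def M_def)
    \<comment> \<open>The product of powers and the sum read only entries below \<open>t\<close>, so
      the others may be set to zero, as \<open>main\<close> demands.\<close>
    let ?n = "\<lambda>i. if i < t then n i else 0"
    have "M ?n = M n" unfolding M_def using ideal_multipow_cong[of t I I ?n n] by simp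
    moreover have "u \<in> M ?n" using main[of J ?n u m] J u m \<open>M ?n = M n\<close> by simp
    ultimately show "u \<in> ideal_smult scale (ideal_multipow I n t) UNIV" by (simp add: M_def)
  qed
qed

end
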